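(* Let $\mathcal{E}$ be a well-pointed, locally finite cartesian closed category. Then every $\mathcal{E}$-recognizable language of $\lambda$-terms is $\mathbf{FinSet}$-recognizable: for every simple type $A$, object $e$ of $\mathcal{E}$ and $F\subseteq\mathcal{E}(1,[\![A]\!]_e)$, there exist a finite set $Q$ and $F'\subseteq[\![A]\!]_Q$ such that $\{t\in\mathrm{Tm}(A)\mid[\![t]\!]_e\in F\} = \{t\in\mathrm{Tm}(A)\mid[\![t]\!]_Q\in F'\}$.
   Context: Simple types: $A ::= o \mid A\to B \mid A\times B \mid 1$; $\mathrm{Tm}(A)$ is the set of closed simply typed $\lambda$-terms (with pairs, projections, unit) of type $A$ modulo $\beta\eta$. For a CCC $\mathcal{C}$ (with specified structure) and object $c$: $[\![o]\!]_c=c$, $[\![A\to B]\!]_c=[\![A]\!]_c\Rightarrow[\![B]\!]_c$, $[\![A\times B]\!]_c=[\![A]\!]_c\times[\![B]\!]_c$, $[\![1]\!]_c=1$, and $[\![t]\!]_c\in\mathcal{C}(1,[\![A]\!]_c)$ is the standard interpretation. $\mathbf{FinSet}$ is the CCC of finite sets and functions (its interpretation is the naive set-theoretic one, and a finite set is identified with its set of points). A CCC is well-pointed if every morphism is determined by its action on points $1\to a$ of its domain, and locally finite if all hom-sets are finite. *)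

theory Defs
  imports Main "HOL-Library.FuncSet" "HOL-Library.FSet"
begin

section \<open>Simply typed lambda-terms modulo beta-eta\<close>

datatype ty = TBase | TFun ty ty | TProd ty ty | TUnit

text \<open>Church-style terms with de Bruijn indices; only abstractions carry a type annotation.\<close>

datatype trm =
    Var nat
  | Lam ty trm
  | App trm trm
  | Tup trm trm
  | Pr1 trm
  | Pr2 trm
  | Triv

inductive typing :: "ty list \<Rightarrow> trm \<Rightarrow> ty \<Rightarrow> bool" where
  typing_Var: "i < length \<Gamma> \<Longrightarrow> typing \<Gamma> (Var i) (\<Gamma> ! i)"
| typing_Lam: "typing (A # \<Gamma>) t B \<Longrightarrow> typing \<Gamma> (Lam A t) (TFun A B)"
| typing_App: "typing \<Gamma> t (TFun A B) \<Longrightarrow> typing \<Gamma> u A \<Longrightarrow> typing \<Gamma> (App t u) B"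
| typing_Tup: "typing \<Gamma> t A \<Longrightarrow> typing \<Gamma> u B \<Longrightarrow> typing \<Gamma> (Tup t u) (TProd A B)"
| typing_Pr1: "typing \<Gamma> t (TProd A B) \<Longrightarrow> typing \<Gamma> (Pr1 t) A"
| typing_Pr2: "typing \<Gamma> t (TProd A B) \<Longrightarrow> typing \<Gamma> (Pr2 t) B"
| typing_Triv: "typing \<Gamma> Triv TUnit"

inductive_cases typing_VarE: "typing \<Gamma> (Var i) A"
inductive_cases typing_LamE: "typing \<Gamma> (Lam A t) B"
inductive_cases typing_AppE: "typing \<Gamma> (App t u) B"
inductive_cases typing_TupE: "typing \<Gamma> (Tup t u) B"
inductive_cases typing_Pr1E: "typing \<Gamma> (Pr1 t) A"
inductive_cases typing_Pr2E: "typing \<Gamma> (Pr2 t) A"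
inductive_cases typing_TrivE: "typing \<Gamma> Triv A"

lemma typing_unique: "typing \<Gamma> t A \<Longrightarrow> typing \<Gamma> t B \<Longrightarrow> A = B"
proof (induction arbitrary: B rule: typing.induct)
  case typing_Var then show ?case by (auto elim: typing_VarE)
next
  case typing_Lam then show ?case by (blast elim: typing_LamE)
next
  case typing_App then show ?case by (blast elim: typing_AppE)
next
  case typing_Tup then show ?case by (blast elim: typing_TupE)
next
  case typing_Pr1 then show ?case by (blast elim: typing_Pr1E)
next
  case typing_Pr2 then show ?case by (blast elim: typing_Pr2E)
next
  case typing_Triv then show ?case by (blast elim: typing_TrivE)
qed

definition ty_of :: "ty list \<Rightarrow> trm \<Rightarrow> ty" where
  "ty_of \<Gamma> t = (THE A. typing \<Gamma> t A)"

lemma ty_of_eq: "typing \<Gamma> t A \<Longrightarrow> ty_of \<Gamma> t = A"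
  unfolding ty_of_def by (blast intro: typing_unique)

primrec ren :: "(nat \<Rightarrow> nat) \<Rightarrow> trm \<Rightarrow> trm" where
  "ren \<xi> (Var i) = Var (\<xi> i)"
| "ren \<xi> (Lam A t) = Lam A (ren (case_nat 0 (Suc \<circ> \<xi>)) t)"
| "ren \<xi> (App t u) = App (ren \<xi> t) (ren \<xi> u)"
| "ren \<xi> (Tup t u) = Tup (ren \<xi> t) (ren \<xi> u)"
| "ren \<xi> (Pr1 t) = Pr1 (ren \<xi> t)"
| "ren \<xi> (Pr2 t) = Pr2 (ren \<xi> t)"
| "ren \<xi> Triv = Triv"

primrec subst :: "(nat \<Rightarrow> trm) \<Rightarrow> trm \<Rightarrow> trm" where
  "subst \<sigma> (Var i) = \<sigma> i"
| "subst \<sigma> (Lam A t) = Lam A (subst (case_nat (Var 0) (ren Suc \<circ> \<sigma>)) t)"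
| "subst \<sigma> (App t u) = App (subst \<sigma> t) (subst \<sigma> u)"
| "subst \<sigma> (Tup t u) = Tup (subst \<sigma> t) (subst \<sigma> u)"
| "subst \<sigma> (Pr1 t) = Pr1 (subst \<sigma> t)"
| "subst \<sigma> (Pr2 t) = Pr2 (subst \<sigma> t)"
| "subst \<sigma> Triv = Triv"

inductive beta_eta :: "ty list \<Rightarrow> trm \<Rightarrow> trm \<Rightarrow> ty \<Rightarrow> bool" where
  be_refl: "typing \<Gamma> t A \<Longrightarrow> beta_eta \<Gamma> t t A"
| be_sym: "beta_eta \<Gamma> t u A \<Longrightarrow> beta_eta \<Gamma> u t A"
| be_trans: "beta_eta \<Gamma> t u A \<Longrightarrow> beta_eta \<Gamma> u v A \<Longrightarrow> beta_eta \<Gamma> t v A"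
| be_Lam: "beta_eta (A # \<Gamma>) t t' B \<Longrightarrow> beta_eta \<Gamma> (Lam A t) (Lam A t') (TFun A B)"
| be_App: "beta_eta \<Gamma> t t' (TFun A B) \<Longrightarrow> beta_eta \<Gamma> u u' A \<Longrightarrow>
    beta_eta \<Gamma> (App t u) (App t' u') B"
| be_Tup: "beta_eta \<Gamma> t t' A \<Longrightarrow> beta_eta \<Gamma> u u' B \<Longrightarrow>
    beta_eta \<Gamma> (Tup t u) (Tup t' u') (TProd A B)"
| be_Pr1: "beta_eta \<Gamma> t t' (TProd A B) \<Longrightarrow> beta_eta \<Gamma> (Pr1 t) (Pr1 t') A"
| be_Pr2: "beta_eta \<Gamma> t t' (TProd A B) \<Longrightarrow> beta_eta \<Gamma> (Pr2 t) (Pr2 t') B"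
| beta_fun: "typing (A # \<Gamma>) t B \<Longrightarrow> typing \<Gamma> u A \<Longrightarrow>
    beta_eta \<Gamma> (App (Lam A t) u) (subst (case_nat u Var) t) B"
| eta_fun: "typing \<Gamma> t (TFun A B) \<Longrightarrow>
    beta_eta \<Gamma> (Lam A (App (ren Suc t) (Var 0))) t (TFun A B)"
| beta_fst: "typing \<Gamma> t A \<Longrightarrow> typing \<Gamma> u B \<Longrightarrow> beta_eta \<Gamma> (Pr1 (Tup t u)) t A"
| beta_snd: "typing \<Gamma> t A \<Longrightarrow> typing \<Gamma> u B \<Longrightarrow> beta_eta \<Gamma> (Pr2 (Tup t u)) u B"
| eta_prod: "typing \<Gamma> t (TProd A B) \<Longrightarrow> beta_eta \<Gamma> (Tup (Pr1 t) (Pr2 t)) t (TProd A B)"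
| eta_unit: "typing \<Gamma> t TUnit \<Longrightarrow> beta_eta \<Gamma> t Triv TUnit"

definition Tm :: "ty \<Rightarrow> trm set set" where
  "Tm A = {t. typing [] t A} // {(t, u). beta_eta [] t u A}"

lemma typing_ren:
  "typing \<Gamma> t A \<Longrightarrow> (\<And>i. i < length \<Gamma> \<Longrightarrow> \<xi> i < length \<Delta> \<and> \<Delta> ! \<xi> i = \<Gamma> ! i) \<Longrightarrow>
    typing \<Delta> (ren \<xi> t) A"
proof (induction arbitrary: \<xi> \<Delta> rule: typing.induct)
  case (typing_Var i \<Gamma>)
  then show ?case using typing.typing_Var[of "\<xi> i" \<Delta>] by simp
next
  case (typing_Lam A \<Gamma> t B)
  have "typing (A # \<Delta>) (ren (case_nat 0 (Suc \<circ> \<xi>)) t) B"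
    by (rule typing_Lam.IH) (use typing_Lam.prems in \<open>auto split: nat.split\<close>)
  then show ?case by (simp add: typing.typing_Lam)
next
  case (typing_App \<Gamma> t A B u)
  from typing_App.IH(1)[OF typing_App.prems] typing_App.IH(2)[OF typing_App.prems]
  show ?case by (simp add: typing.typing_App)
next
  case (typing_Tup \<Gamma> t A u B)
  from typing_Tup.IH(1)[OF typing_Tup.prems] typing_Tup.IH(2)[OF typing_Tup.prems]
  show ?case by (simp add: typing.typing_Tup)
next
  case (typing_Pr1 \<Gamma> t A B)
  from typing_Pr1.IH[OF typing_Pr1.prems] show ?case by (auto intro: typing.typing_Pr1)
next
  case (typing_Pr2 \<Gamma> t A B)
  from typing_Pr2.IH[OF typing_Pr2.prems] show ?case by (auto intro: typing.typing_Pr2)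
qed (simp_all add: typing.typing_Triv)

lemma typing_subst:
  "typing \<Gamma> t A \<Longrightarrow> (\<And>i. i < length \<Gamma> \<Longrightarrow> typing \<Delta> (\<sigma> i) (\<Gamma> ! i)) \<Longrightarrow>
    typing \<Delta> (subst \<sigma> t) A"
proof (induction arbitrary: \<sigma> \<Delta> rule: typing.induct)
  case (typing_Lam A \<Gamma> t B)
  have "typing (A # \<Delta>) (subst (case_nat (Var 0) (ren Suc \<circ> \<sigma>)) t) B"
  proof (rule typing_Lam.IH)
    fix i assume i: "i < length (A # \<Gamma>)"
    show "typing (A # \<Delta>) (case_nat (Var 0) (ren Suc \<circ> \<sigma>) i) ((A # \<Gamma>) ! i)"
    proof (cases i)
      case 0
      then show ?thesis using typing.typing_Var[of 0 "A # \<Delta>"] by simp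
    next
      case (Suc j)
      then show ?thesis using i typing_Lam.prems[of j] by (auto intro: typing_ren)
    qed
  qed
  then show ?case by (simp add: typing.typing_Lam)
next
  case (typing_App \<Gamma> t A B u)
  from typing_App.IH(1)[OF typing_App.prems] typing_App.IH(2)[OF typing_App.prems]
  show ?case by (simp add: typing.typing_App)
next
  case (typing_Tup \<Gamma> t A u B)
  from typing_Tup.IH(1)[OF typing_Tup.prems] typing_Tup.IH(2)[OF typing_Tup.prems]
  show ?case by (simp add: typing.typing_Tup)
next
  case (typing_Pr1 \<Gamma> t A B)
  from typing_Pr1.IH[OF typing_Pr1.prems] show ?case by (auto intro: typing.typing_Pr1)
next
  case (typing_Pr2 \<Gamma> t A B)
  from typing_Pr2.IH[OF typing_Pr2.prems] show ?case by (auto intro: typing.typing_Pr2)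
qed (simp_all add: typing.typing_Triv)

lemma typing_subst_single:
  assumes "typing (A # \<Gamma>) t B" "typing \<Gamma> u A"
  shows "typing \<Gamma> (subst (case_nat u Var) t) B"
  by (rule typing_subst[OF assms(1)]) (auto split: nat.split intro: typing.intros assms)

lemma typing_weaken: "typing \<Gamma> t B \<Longrightarrow> typing (A # \<Gamma>) (ren Suc t) B"
  by (erule typing_ren) auto

lemma beta_eta_typing: "beta_eta \<Gamma> t u A \<Longrightarrow> typing \<Gamma> t A \<and> typing \<Gamma> u A"
proof (induction rule: beta_eta.induct)
  case (eta_fun \<Gamma> t A B)
  then show ?case
    using typing.typing_Var[of 0 "A # \<Gamma>"] by (auto intro!: typing.intros typing_weaken)
qed (auto intro: typing.intros typing_subst_single)

lemma equiv_beta_eta: "equiv {t. typing [] t A} {(t, u). beta_eta [] t u A}"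
  by (rule equivI)
    (auto simp: refl_on_def sym_def trans_def dest: beta_eta_typing
      intro: beta_eta.intros(1,2) be_trans)

section \<open>Cartesian closed categories with specified structure\<close>

text \<open>Hom-sets need not be disjoint, so the operations take the objects involved as arguments:
  the composite \<open>g \<circ> f\<close> of \<open>f : a \<rightarrow> b\<close> and \<open>g : b \<rightarrow> c\<close> is \<open>Comp C a b c g f\<close>, the pairing of
  \<open>f : c \<rightarrow> a\<close> and \<open>g : c \<rightarrow> b\<close> is \<open>Pairing C c a b f g\<close>, \<open>Exp C a b\<close> is \<open>a \<Rightarrow> b\<close>, and the
  transpose of \<open>f : c \<times> a \<rightarrow> b\<close> is \<open>Curry C c a b f\<close>.\<close>

record ('o, 'm) cat =
  Obj :: "'o set"
  Hom :: "'o \<Rightarrow> 'o \<Rightarrow> 'm set"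
  Id :: "'o \<Rightarrow> 'm"
  Comp :: "'o \<Rightarrow> 'o \<Rightarrow> 'o \<Rightarrow> 'm \<Rightarrow> 'm \<Rightarrow> 'm"
  One :: "'o"
  Bang :: "'o \<Rightarrow> 'm"
  Prd :: "'o \<Rightarrow> 'o \<Rightarrow> 'o"
  Fst :: "'o \<Rightarrow> 'o \<Rightarrow> 'm"
  Snd :: "'o \<Rightarrow> 'o \<Rightarrow> 'm"
  Pairing :: "'o \<Rightarrow> 'o \<Rightarrow> 'o \<Rightarrow> 'm \<Rightarrow> 'm \<Rightarrow> 'm"
  Exp :: "'o \<Rightarrow> 'o \<Rightarrow> 'o"
  Eval :: "'o \<Rightarrow> 'o \<Rightarrow> 'm"
  Curry :: "'o \<Rightarrow> 'o \<Rightarrow> 'o \<Rightarrow> 'm \<Rightarrow> 'm"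

locale cartesian_closed =
  fixes C :: "('o, 'm) cat"
  assumes Id_in: "a \<in> Obj C \<Longrightarrow> Id C a \<in> Hom C a a"
    and Comp_in: "\<lbrakk>a \<in> Obj C; b \<in> Obj C; c \<in> Obj C; f \<in> Hom C a b; g \<in> Hom C b c\<rbrakk> \<Longrightarrow>
      Comp C a b c g f \<in> Hom C a c"
    and Id_left: "\<lbrakk>a \<in> Obj C; b \<in> Obj C; f \<in> Hom C a b\<rbrakk> \<Longrightarrow> Comp C a b b (Id C b) f = f"
    and Id_right: "\<lbrakk>a \<in> Obj C; b \<in> Obj C; f \<in> Hom C a b\<rbrakk> \<Longrightarrow> Comp C a a b f (Id C a) = f"
    and Comp_assoc: "\<lbrakk>a \<in> Obj C; b \<in> Obj C; c \<in> Obj C; d \<in> Obj C;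
      f \<in> Hom C a b; g \<in> Hom C b c; h \<in> Hom C c d\<rbrakk> \<Longrightarrow>
      Comp C a b d (Comp C b c d h g) f = Comp C a c d h (Comp C a b c g f)"
    and One_in: "One C \<in> Obj C"
    and Bang_in: "a \<in> Obj C \<Longrightarrow> Bang C a \<in> Hom C a (One C)"
    and Bang_unique: "\<lbrakk>a \<in> Obj C; f \<in> Hom C a (One C)\<rbrakk> \<Longrightarrow> f = Bang C a"
    and Prd_in: "\<lbrakk>a \<in> Obj C; b \<in> Obj C\<rbrakk> \<Longrightarrow> Prd C a b \<in> Obj C"
    and Fst_in: "\<lbrakk>a \<in> Obj C; b \<in> Obj C\<rbrakk> \<Longrightarrow> Fst C a b \<in> Hom C (Prd C a b) a"
    and Snd_in: "\<lbrakk>a \<in> Obj C; b \<in> Obj C\<rbrakk> \<Longrightarrow> Snd C a b \<in> Hom C (Prd C a b) b"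
    and Pairing_in: "\<lbrakk>c \<in> Obj C; a \<in> Obj C; b \<in> Obj C; f \<in> Hom C c a; g \<in> Hom C c b\<rbrakk> \<Longrightarrow>
      Pairing C c a b f g \<in> Hom C c (Prd C a b)"
    and Fst_Pairing: "\<lbrakk>c \<in> Obj C; a \<in> Obj C; b \<in> Obj C; f \<in> Hom C c a; g \<in> Hom C c b\<rbrakk> \<Longrightarrow>
      Comp C c (Prd C a b) a (Fst C a b) (Pairing C c a b f g) = f"
    and Snd_Pairing: "\<lbrakk>c \<in> Obj C; a \<in> Obj C; b \<in> Obj C; f \<in> Hom C c a; g \<in> Hom C c b\<rbrakk> \<Longrightarrow>
      Comp C c (Prd C a b) b (Snd C a b) (Pairing C c a b f g) = g"
    and Pairing_unique: "\<lbrakk>c \<in> Obj C; a \<in> Obj C; b \<in> Obj C; h \<in> Hom C c (Prd C a b)\<rbrakk> \<Longrightarrow>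
      h = Pairing C c a b (Comp C c (Prd C a b) a (Fst C a b) h)
            (Comp C c (Prd C a b) b (Snd C a b) h)"
    and Exp_in: "\<lbrakk>a \<in> Obj C; b \<in> Obj C\<rbrakk> \<Longrightarrow> Exp C a b \<in> Obj C"
    and Eval_in: "\<lbrakk>a \<in> Obj C; b \<in> Obj C\<rbrakk> \<Longrightarrow> Eval C a b \<in> Hom C (Prd C (Exp C a b) a) b"
    and Curry_in: "\<lbrakk>c \<in> Obj C; a \<in> Obj C; b \<in> Obj C; f \<in> Hom C (Prd C c a) b\<rbrakk> \<Longrightarrow>
      Curry C c a b f \<in> Hom C c (Exp C a b)"
    and Eval_Curry: "\<lbrakk>c \<in> Obj C; a \<in> Obj C; b \<in> Obj C; f \<in> Hom C (Prd C c a) b\<rbrakk> \<Longrightarrow>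
      Comp C (Prd C c a) (Prd C (Exp C a b) a) b (Eval C a b)
        (Pairing C (Prd C c a) (Exp C a b) a
          (Comp C (Prd C c a) c (Exp C a b) (Curry C c a b f) (Fst C c a)) (Snd C c a)) = f"
    and Curry_unique: "\<lbrakk>c \<in> Obj C; a \<in> Obj C; b \<in> Obj C; g \<in> Hom C c (Exp C a b)\<rbrakk> \<Longrightarrow>
      g = Curry C c a b (Comp C (Prd C c a) (Prd C (Exp C a b) a) b (Eval C a b)
        (Pairing C (Prd C c a) (Exp C a b) a
          (Comp C (Prd C c a) c (Exp C a b) g (Fst C c a)) (Snd C c a)))"

definition well_pointed :: "('o, 'm) cat \<Rightarrow> bool" where
  "well_pointed C \<longleftrightarrow> (\<forall>a \<in> Obj C. \<forall>b \<in> Obj C. \<forall>f \<in> Hom C a b. \<forall>g \<in> Hom C a b.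
     (\<forall>x \<in> Hom C (One C) a. Comp C (One C) a b f x = Comp C (One C) a b g x) \<longrightarrow> f = g)"

definition locally_finite :: "('o, 'm) cat \<Rightarrow> bool" where
  "locally_finite C \<longleftrightarrow> (\<forall>a \<in> Obj C. \<forall>b \<in> Obj C. finite (Hom C a b))"

section \<open>Interpretation of terms\<close>

primrec ty_sem :: "('o, 'm) cat \<Rightarrow> 'o \<Rightarrow> ty \<Rightarrow> 'o" where
  "ty_sem C c TBase = c"
| "ty_sem C c (TFun A B) = Exp C (ty_sem C c A) (ty_sem C c B)"
| "ty_sem C c (TProd A B) = Prd C (ty_sem C c A) (ty_sem C c B)"
| "ty_sem C c TUnit = One C"

primrec ctx_sem :: "('o, 'm) cat \<Rightarrow> 'o \<Rightarrow> ty list \<Rightarrow> 'o" where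
  "ctx_sem C c [] = One C"
| "ctx_sem C c (A # \<Gamma>) = Prd C (ctx_sem C c \<Gamma>) (ty_sem C c A)"

fun var_sem :: "('o, 'm) cat \<Rightarrow> 'o \<Rightarrow> ty list \<Rightarrow> nat \<Rightarrow> 'm" where
  "var_sem C c [] i = undefined"
| "var_sem C c (A # \<Gamma>) 0 = Snd C (ctx_sem C c \<Gamma>) (ty_sem C c A)"
| "var_sem C c (A # \<Gamma>) (Suc i) =
    Comp C (ctx_sem C c (A # \<Gamma>)) (ctx_sem C c \<Gamma>) (ty_sem C c (\<Gamma> ! i))
      (var_sem C c \<Gamma> i) (Fst C (ctx_sem C c \<Gamma>) (ty_sem C c A))"

text \<open>A term \<open>t\<close> of type \<open>A\<close> in context \<open>\<Gamma>\<close> denotes a morphism from \<open>ctx_sem C c \<Gamma>\<close> to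
  \<open>ty_sem C c A\<close>; values on ill-typed arguments are irrelevant.\<close>

fun sem :: "('o, 'm) cat \<Rightarrow> 'o \<Rightarrow> ty list \<Rightarrow> trm \<Rightarrow> 'm" where
  "sem C c \<Gamma> (Var i) = var_sem C c \<Gamma> i"
| "sem C c \<Gamma> (Lam A t) =
    Curry C (ctx_sem C c \<Gamma>) (ty_sem C c A) (ty_sem C c (ty_of (A # \<Gamma>) t)) (sem C c (A # \<Gamma>) t)"
| "sem C c \<Gamma> (App t u) =
    (let g = ctx_sem C c \<Gamma>; a = ty_sem C c (ty_of \<Gamma> u); b = ty_sem C c (ty_of \<Gamma> (App t u))
     in Comp C g (Prd C (Exp C a b) a) b (Eval C a b)
          (Pairing C g (Exp C a b) a (sem C c \<Gamma> t) (sem C c \<Gamma> u)))"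
| "sem C c \<Gamma> (Tup t u) =
    Pairing C (ctx_sem C c \<Gamma>) (ty_sem C c (ty_of \<Gamma> t)) (ty_sem C c (ty_of \<Gamma> u))
      (sem C c \<Gamma> t) (sem C c \<Gamma> u)"
| "sem C c \<Gamma> (Pr1 t) =
    (let g = ctx_sem C c \<Gamma>; a = ty_sem C c (ty_of \<Gamma> (Pr1 t)); b = ty_sem C c (ty_of \<Gamma> (Pr2 t))
     in Comp C g (Prd C a b) a (Fst C a b) (sem C c \<Gamma> t))"
| "sem C c \<Gamma> (Pr2 t) =
    (let g = ctx_sem C c \<Gamma>; a = ty_sem C c (ty_of \<Gamma> (Pr1 t)); b = ty_sem C c (ty_of \<Gamma> (Pr2 t))
     in Comp C g (Prd C a b) b (Snd C a b) (sem C c \<Gamma> t))"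
| "sem C c \<Gamma> Triv = Bang C (ctx_sem C c \<Gamma>)"

text \<open>The interpretation of a beta-eta class of closed terms is the common value of \<open>sem\<close> on its
  members; lemma \<open>interp_eq\<close> below shows that it is well defined.\<close>

definition interp :: "('o, 'm) cat \<Rightarrow> 'o \<Rightarrow> trm set \<Rightarrow> 'm" where
  "interp C c T = the_elem (sem C c [] ` T)"

context cartesian_closed
begin

lemmas cat_in = Id_in Comp_in One_in Bang_in Prd_in Fst_in Snd_in Pairing_in Exp_in Eval_in Curry_in

lemma ty_sem_in: "c \<in> Obj C \<Longrightarrow> ty_sem C c A \<in> Obj C"
  by (induction A) (auto intro: cat_in)

lemma ctx_sem_in: "c \<in> Obj C \<Longrightarrow> ctx_sem C c \<Gamma> \<in> Obj C"
  by (induction \<Gamma>) (auto intro: cat_in ty_sem_in)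

lemma var_sem_in:
  "c \<in> Obj C \<Longrightarrow> i < length \<Gamma> \<Longrightarrow> var_sem C c \<Gamma> i \<in> Hom C (ctx_sem C c \<Gamma>) (ty_sem C c (\<Gamma> ! i))"
proof (induction \<Gamma> arbitrary: i)
  case (Cons A \<Gamma>)
  then show ?case by (cases i) (auto intro!: cat_in ty_sem_in ctx_sem_in)
qed simp

lemma sem_in:
  "typing \<Gamma> t A \<Longrightarrow> c \<in> Obj C \<Longrightarrow> sem C c \<Gamma> t \<in> Hom C (ctx_sem C c \<Gamma>) (ty_sem C c A)"
proof (induction rule: typing.induct)
  case (typing_Var i \<Gamma>)
  then show ?case by (simp add: var_sem_in)
next
  case (typing_Lam A \<Gamma> t B)
  then show ?case by (auto simp: ty_of_eq intro!: cat_in ty_sem_in ctx_sem_in)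
next
  case (typing_App \<Gamma> t A B u)
  then show ?case
    by (auto simp: Let_def ty_of_eq ty_of_eq[OF typing.typing_App]
        intro!: cat_in ty_sem_in ctx_sem_in)
next
  case (typing_Tup \<Gamma> t A u B)
  then show ?case by (auto simp: ty_of_eq intro!: cat_in ty_sem_in ctx_sem_in)
next
  case (typing_Pr1 \<Gamma> t A B)
  then show ?case
    by (auto simp: Let_def ty_of_eq[OF typing.typing_Pr1] ty_of_eq[OF typing.typing_Pr2]
        intro!: cat_in ty_sem_in ctx_sem_in)
next
  case (typing_Pr2 \<Gamma> t A B)
  then show ?case
    by (auto simp: Let_def ty_of_eq[OF typing.typing_Pr1] ty_of_eq[OF typing.typing_Pr2]
        intro!: cat_in ty_sem_in ctx_sem_in)
next
  case (typing_Triv \<Gamma>)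
  then show ?case by (auto intro!: cat_in ctx_sem_in)
qed

lemma Pairing_Comp:
  assumes "d \<in> Obj C" "c \<in> Obj C" "a \<in> Obj C" "b \<in> Obj C"
    "f \<in> Hom C c a" "g \<in> Hom C c b" "m \<in> Hom C d c"
  shows "Comp C d c (Prd C a b) (Pairing C c a b f g) m =
    Pairing C d a b (Comp C d c a f m) (Comp C d c b g m)"
proof -
  let ?p = "Pairing C c a b f g"
  have p: "?p \<in> Hom C c (Prd C a b)" "Prd C a b \<in> Obj C" using assms by (auto intro: cat_in)
  have h: "Comp C d c (Prd C a b) ?p m \<in> Hom C d (Prd C a b)" using assms p by (auto intro: cat_in)
  have "Comp C d (Prd C a b) a (Fst C a b) (Comp C d c (Prd C a b) ?p m) = Comp C d c a f m"
    using assms p Comp_assoc[OF assms(1,2) p(2) assms(3,7) p(1) Fst_in[OF assms(3,4)]]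
    by (simp add: Fst_Pairing)
  moreover have "Comp C d (Prd C a b) b (Snd C a b) (Comp C d c (Prd C a b) ?p m) = Comp C d c b g m"
    using assms p Comp_assoc[OF assms(1,2) p(2) assms(4,7) p(1) Snd_in[OF assms(3,4)]]
    by (simp add: Snd_Pairing)
  ultimately show ?thesis using Pairing_unique[OF assms(1,3,4) h] by simp
qed

definition lift_mor :: "'o \<Rightarrow> 'o \<Rightarrow> 'o \<Rightarrow> 'm \<Rightarrow> 'm" where
  "lift_mor d c a m = Pairing C (Prd C d a) c a (Comp C (Prd C d a) d c m (Fst C d a)) (Snd C d a)"

lemma lift_mor_in:
  assumes "d \<in> Obj C" "c \<in> Obj C" "a \<in> Obj C" "m \<in> Hom C d c"
  shows "lift_mor d c a m \<in> Hom C (Prd C d a) (Prd C c a)"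
  unfolding lift_mor_def using assms by (auto intro!: cat_in)

lemma Fst_lift_mor:
  assumes "d \<in> Obj C" "c \<in> Obj C" "a \<in> Obj C" "m \<in> Hom C d c"
  shows "Comp C (Prd C d a) (Prd C c a) c (Fst C c a) (lift_mor d c a m) =
    Comp C (Prd C d a) d c m (Fst C d a)"
  unfolding lift_mor_def by (rule Fst_Pairing) (use assms in \<open>auto intro!: cat_in\<close>)

lemma Snd_lift_mor:
  assumes "d \<in> Obj C" "c \<in> Obj C" "a \<in> Obj C" "m \<in> Hom C d c"
  shows "Comp C (Prd C d a) (Prd C c a) a (Snd C c a) (lift_mor d c a m) = Snd C d a"
  unfolding lift_mor_def by (rule Snd_Pairing) (use assms in \<open>auto intro!: cat_in\<close>)

lemma Curry_Comp:
  assumes "d \<in> Obj C" "c \<in> Obj C" "a \<in> Obj C" "b \<in> Obj C"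
    "f \<in> Hom C (Prd C c a) b" "m \<in> Hom C d c"
  shows "Comp C d c (Exp C a b) (Curry C c a b f) m =
    Curry C d a b (Comp C (Prd C d a) (Prd C c a) b f (lift_mor d c a m))"
proof -
  let ?g = "Comp C d c (Exp C a b) (Curry C c a b f) m"
  let ?e = "Exp C a b" and ?da = "Prd C d a" and ?ca = "Prd C c a"
  let ?l = "lift_mor d c a m"
  have o: "?e \<in> Obj C" "?da \<in> Obj C" "?ca \<in> Obj C" "Prd C ?e a \<in> Obj C"
    using assms by (auto intro!: cat_in)
  have l: "?l \<in> Hom C ?da ?ca" using assms lift_mor_in by blast
  have cf: "Curry C c a b f \<in> Hom C c ?e" using assms by (auto intro!: cat_in)
  have g: "?g \<in> Hom C d ?e" using assms cf o by (auto intro!: cat_in)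
  have cf1: "Comp C ?ca c ?e (Curry C c a b f) (Fst C c a) \<in> Hom C ?ca ?e"
    using assms cf o by (auto intro!: cat_in)
  have p: "Pairing C ?ca ?e a (Comp C ?ca c ?e (Curry C c a b f) (Fst C c a)) (Snd C c a)
      \<in> Hom C ?ca (Prd C ?e a)"
    using assms cf1 o by (auto intro!: cat_in)
  have "Comp C ?da d ?e ?g (Fst C d a) =
      Comp C ?da ?ca ?e (Comp C ?ca c ?e (Curry C c a b f) (Fst C c a)) ?l"
    using assms o cf l by (simp add: Comp_assoc cat_in Fst_lift_mor)
  moreover have "Snd C d a = Comp C ?da ?ca a (Snd C c a) ?l"
    using assms by (simp add: Snd_lift_mor)
  ultimately have "Pairing C ?da ?e a (Comp C ?da d ?e ?g (Fst C d a)) (Snd C d a) =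
      Comp C ?da ?ca (Prd C ?e a)
        (Pairing C ?ca ?e a (Comp C ?ca c ?e (Curry C c a b f) (Fst C c a)) (Snd C c a)) ?l"
    using Pairing_Comp[OF o(2,3,1) assms(3) cf1 Snd_in[OF assms(2,3)] l] by simp
  then have "Comp C ?da (Prd C ?e a) b (Eval C a b)
      (Pairing C ?da ?e a (Comp C ?da d ?e ?g (Fst C d a)) (Snd C d a)) = Comp C ?da ?ca b f ?l"
    using Comp_assoc[OF o(2,3,4) assms(4) l p Eval_in[OF assms(3,4)]]
      Eval_Curry[OF assms(2,3,4,5)] by simp
  then show ?thesis using Curry_unique[OF assms(1,3,4) g] by simp
qed

lemma sem_App:
  assumes "typing \<Gamma> t (TFun A B)" "typing \<Gamma> u A"
  shows "sem C c \<Gamma> (App t u) = Comp C (ctx_sem C c \<Gamma>)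
    (Prd C (Exp C (ty_sem C c A) (ty_sem C c B)) (ty_sem C c A)) (ty_sem C c B)
    (Eval C (ty_sem C c A) (ty_sem C c B))
    (Pairing C (ctx_sem C c \<Gamma>) (Exp C (ty_sem C c A) (ty_sem C c B)) (ty_sem C c A)
      (sem C c \<Gamma> t) (sem C c \<Gamma> u))"
  using assms by (simp add: Let_def ty_of_eq ty_of_eq[OF typing.typing_App[OF assms]])

lemma sem_Lam:
  assumes "typing (A # \<Gamma>) t B"
  shows "sem C c \<Gamma> (Lam A t) =
    Curry C (ctx_sem C c \<Gamma>) (ty_sem C c A) (ty_sem C c B) (sem C c (A # \<Gamma>) t)"
  using assms by (simp add: ty_of_eq)

lemma sem_Tup:
  assumes "typing \<Gamma> t A" "typing \<Gamma> u B"
  shows "sem C c \<Gamma> (Tup t u) = Pairing C (ctx_sem C c \<Gamma>) (ty_sem C c A) (ty_sem C c B)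
    (sem C c \<Gamma> t) (sem C c \<Gamma> u)"
  using assms by (simp add: ty_of_eq)

lemma sem_Pr1:
  assumes "typing \<Gamma> t (TProd A B)"
  shows "sem C c \<Gamma> (Pr1 t) = Comp C (ctx_sem C c \<Gamma>) (Prd C (ty_sem C c A) (ty_sem C c B))
    (ty_sem C c A) (Fst C (ty_sem C c A) (ty_sem C c B)) (sem C c \<Gamma> t)"
  by (simp add: Let_def ty_of_eq[OF typing.typing_Pr1[OF assms]]
      ty_of_eq[OF typing.typing_Pr2[OF assms]])

lemma sem_Pr2:
  assumes "typing \<Gamma> t (TProd A B)"
  shows "sem C c \<Gamma> (Pr2 t) = Comp C (ctx_sem C c \<Gamma>) (Prd C (ty_sem C c A) (ty_sem C c B))
    (ty_sem C c B) (Snd C (ty_sem C c A) (ty_sem C c B)) (sem C c \<Gamma> t)"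
  by (simp add: Let_def ty_of_eq[OF typing.typing_Pr1[OF assms]]
      ty_of_eq[OF typing.typing_Pr2[OF assms]])

declare sem.simps(2-6)[simp del]

lemma sem_ren:
  assumes "typing \<Gamma> t A" "c \<in> Obj C" "m \<in> Hom C (ctx_sem C c \<Delta>) (ctx_sem C c \<Gamma>)"
    "\<And>i. i < length \<Gamma> \<Longrightarrow> \<xi> i < length \<Delta> \<and> \<Delta> ! \<xi> i = \<Gamma> ! i \<and> var_sem C c \<Delta> (\<xi> i) =
      Comp C (ctx_sem C c \<Delta>) (ctx_sem C c \<Gamma>) (ty_sem C c (\<Gamma> ! i)) (var_sem C c \<Gamma> i) m"
  shows "sem C c \<Delta> (ren \<xi> t) =
    Comp C (ctx_sem C c \<Delta>) (ctx_sem C c \<Gamma>) (ty_sem C c A) (sem C c \<Gamma> t) m"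
  using assms
proof (induction arbitrary: \<xi> \<Delta> m rule: typing.induct)
  case (typing_Var i \<Gamma>)
  show ?case using typing_Var.prems(3)[OF typing_Var.hyps] by simp
next
  case (typing_Lam A \<Gamma> t B)
  let ?\<xi> = "case_nat 0 (Suc \<circ> \<xi>)"
  let ?d = "ctx_sem C c \<Delta>" and ?g = "ctx_sem C c \<Gamma>" and ?a = "ty_sem C c A" and ?b = "ty_sem C c B"
  note c = \<open>c \<in> Obj C\<close>
  note o = ctx_sem_in[OF c] ty_sem_in[OF c]
  have m: "m \<in> Hom C ?d ?g" by fact
  have l: "lift_mor ?d ?g ?a m \<in> Hom C (ctx_sem C c (A # \<Delta>)) (ctx_sem C c (A # \<Gamma>))"
    using m by (auto intro: lift_mor_in o)
  have v: "?\<xi> i < length (A # \<Delta>) \<and> (A # \<Delta>) ! ?\<xi> i = (A # \<Gamma>) ! i \<and> var_sem C c (A # \<Delta>) (?\<xi> i) =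
      Comp C (ctx_sem C c (A # \<Delta>)) (ctx_sem C c (A # \<Gamma>)) (ty_sem C c ((A # \<Gamma>) ! i))
        (var_sem C c (A # \<Gamma>) i) (lift_mor ?d ?g ?a m)" if i: "i < length (A # \<Gamma>)" for i
  proof (cases i)
    case 0
    then show ?thesis using m by (simp add: Snd_lift_mor o)
  next
    case (Suc j)
    then have j: "j < length \<Gamma>" using i by simp
    show ?thesis
      using Suc typing_Lam.prems(3)[OF j] var_sem_in[OF c j] m l
      by (simp add: Comp_assoc Fst_lift_mor o cat_in)
  qed
  have ty: "typing (A # \<Delta>) (ren ?\<xi> t) B"
    by (rule typing_ren[OF typing_Lam.hyps]) (use v in blast)
  have ih: "sem C c (A # \<Delta>) (ren ?\<xi> t) =
      Comp C (ctx_sem C c (A # \<Delta>)) (ctx_sem C c (A # \<Gamma>)) ?b (sem C c (A # \<Gamma>) t)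
        (lift_mor ?d ?g ?a m)"
    by (rule typing_Lam.IH[OF c l]) (rule v)
  show ?case
    using m sem_in[OF typing_Lam.hyps c]
    by (simp add: sem_Lam[OF typing_Lam.hyps] sem_Lam[OF ty] ih Curry_Comp o)
next
  case (typing_App \<Gamma> t A B u)
  note ih = typing_App.IH(1)[OF typing_App.prems] typing_App.IH(2)[OF typing_App.prems]
  have ty: "typing \<Delta> (ren \<xi> t) (TFun A B)" "typing \<Delta> (ren \<xi> u) A"
    using typing_App.hyps typing_App.prems by (auto intro: typing_ren)
  note c = \<open>c \<in> Obj C\<close>
  show ?case
    using typing_App.prems(2) sem_in[OF typing_App.hyps(1) c] sem_in[OF typing_App.hyps(2) c]
    by (simp add: sem_App[OF ty] sem_App[OF typing_App.hyps] ih c Comp_assoc Pairing_Comp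
        cat_in ty_sem_in ctx_sem_in)
next
  case (typing_Tup \<Gamma> t A u B)
  note ih = typing_Tup.IH(1)[OF typing_Tup.prems] typing_Tup.IH(2)[OF typing_Tup.prems]
  have ty: "typing \<Delta> (ren \<xi> t) A" "typing \<Delta> (ren \<xi> u) B"
    using typing_Tup.hyps typing_Tup.prems by (auto intro: typing_ren)
  note c = \<open>c \<in> Obj C\<close>
  show ?case
    using typing_Tup.prems(2) sem_in[OF typing_Tup.hyps(1) c] sem_in[OF typing_Tup.hyps(2) c]
    by (simp add: sem_Tup[OF ty] sem_Tup[OF typing_Tup.hyps] ih c Pairing_Comp
        cat_in ty_sem_in ctx_sem_in)
next
  case (typing_Pr1 \<Gamma> t A B)
  note ih = typing_Pr1.IH[OF typing_Pr1.prems]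
  have ty: "typing \<Delta> (ren \<xi> t) (TProd A B)"
    using typing_Pr1.hyps typing_Pr1.prems by (auto intro: typing_ren)
  note c = \<open>c \<in> Obj C\<close>
  show ?case
    using typing_Pr1.prems(2) sem_in[OF typing_Pr1.hyps(1) c]
    by (simp add: sem_Pr1[OF ty] sem_Pr1[OF typing_Pr1.hyps] ih c Comp_assoc
        cat_in ty_sem_in ctx_sem_in)
next
  case (typing_Pr2 \<Gamma> t A B)
  note ih = typing_Pr2.IH[OF typing_Pr2.prems]
  have ty: "typing \<Delta> (ren \<xi> t) (TProd A B)"
    using typing_Pr2.hyps typing_Pr2.prems by (auto intro: typing_ren)
  note c = \<open>c \<in> Obj C\<close>
  show ?case
    using typing_Pr2.prems(2) sem_in[OF typing_Pr2.hyps(1) c]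
    by (simp add: sem_Pr2[OF ty] sem_Pr2[OF typing_Pr2.hyps] ih c Comp_assoc
        cat_in ty_sem_in ctx_sem_in)
next
  case (typing_Triv \<Gamma>)
  then have "Comp C (ctx_sem C c \<Delta>) (ctx_sem C c \<Gamma>) (One C) (Bang C (ctx_sem C c \<Gamma>)) m =
      Bang C (ctx_sem C c \<Delta>)"
    by (intro Bang_unique) (simp_all add: cat_in ctx_sem_in)
  then show ?case by simp
qed

lemma sem_weaken:
  assumes "typing \<Gamma> t B" "c \<in> Obj C"
  shows "sem C c (A # \<Gamma>) (ren Suc t) =
    Comp C (ctx_sem C c (A # \<Gamma>)) (ctx_sem C c \<Gamma>) (ty_sem C c B) (sem C c \<Gamma> t)
      (Fst C (ctx_sem C c \<Gamma>) (ty_sem C c A))"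
  by (rule sem_ren[OF assms]) (simp_all add: cat_in ctx_sem_in ty_sem_in assms)

lemma sem_subst:
  assumes "typing \<Gamma> t A" "c \<in> Obj C" "m \<in> Hom C (ctx_sem C c \<Delta>) (ctx_sem C c \<Gamma>)"
    "\<And>i. i < length \<Gamma> \<Longrightarrow> typing \<Delta> (\<sigma> i) (\<Gamma> ! i) \<and> sem C c \<Delta> (\<sigma> i) =
      Comp C (ctx_sem C c \<Delta>) (ctx_sem C c \<Gamma>) (ty_sem C c (\<Gamma> ! i)) (var_sem C c \<Gamma> i) m"
  shows "sem C c \<Delta> (subst \<sigma> t) =
    Comp C (ctx_sem C c \<Delta>) (ctx_sem C c \<Gamma>) (ty_sem C c A) (sem C c \<Gamma> t) m"
  using assms
proof (induction arbitrary: \<sigma> \<Delta> m rule: typing.induct)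
  case (typing_Var i \<Gamma>)
  show ?case using typing_Var.prems(3)[OF typing_Var.hyps] by simp
next
  case (typing_Lam A \<Gamma> t B)
  let ?\<sigma> = "case_nat (Var 0) (ren Suc \<circ> \<sigma>)"
  let ?d = "ctx_sem C c \<Delta>" and ?g = "ctx_sem C c \<Gamma>" and ?a = "ty_sem C c A" and ?b = "ty_sem C c B"
  note c = \<open>c \<in> Obj C\<close>
  note o = ctx_sem_in[OF c] ty_sem_in[OF c]
  have m: "m \<in> Hom C ?d ?g" by fact
  have l: "lift_mor ?d ?g ?a m \<in> Hom C (ctx_sem C c (A # \<Delta>)) (ctx_sem C c (A # \<Gamma>))"
    using m by (auto intro: lift_mor_in o)
  have v: "typing (A # \<Delta>) (?\<sigma> i) ((A # \<Gamma>) ! i) \<and> sem C c (A # \<Delta>) (?\<sigma> i) =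
      Comp C (ctx_sem C c (A # \<Delta>)) (ctx_sem C c (A # \<Gamma>)) (ty_sem C c ((A # \<Gamma>) ! i))
        (var_sem C c (A # \<Gamma>) i) (lift_mor ?d ?g ?a m)" if i: "i < length (A # \<Gamma>)" for i
  proof (cases i)
    case 0
    then show ?thesis using m typing.typing_Var[of 0 "A # \<Delta>"] by (simp add: Snd_lift_mor o)
  next
    case (Suc j)
    then have j: "j < length \<Gamma>" using i by simp
    have ty: "typing \<Delta> (\<sigma> j) (\<Gamma> ! j)" and eq: "sem C c \<Delta> (\<sigma> j) =
        Comp C ?d ?g (ty_sem C c (\<Gamma> ! j)) (var_sem C c \<Gamma> j) m"
      using typing_Lam.prems(3)[OF j] by auto
    show ?thesis
      using var_sem_in[OF c j] m l
      by (simp add: Suc sem_weaken[OF ty c] eq Comp_assoc Fst_lift_mor o cat_in typing_weaken[OF ty])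
  qed
  have ty: "typing (A # \<Delta>) (subst ?\<sigma> t) B"
    by (rule typing_subst[OF typing_Lam.hyps]) (use v in blast)
  have ih: "sem C c (A # \<Delta>) (subst ?\<sigma> t) =
      Comp C (ctx_sem C c (A # \<Delta>)) (ctx_sem C c (A # \<Gamma>)) ?b (sem C c (A # \<Gamma>) t)
        (lift_mor ?d ?g ?a m)"
    by (rule typing_Lam.IH[OF c l]) (rule v)
  show ?case
    using m sem_in[OF typing_Lam.hyps c]
    by (simp add: sem_Lam[OF typing_Lam.hyps] sem_Lam[OF ty] ih Curry_Comp o)
next
  case (typing_App \<Gamma> t A B u)
  note ih = typing_App.IH(1)[OF typing_App.prems] typing_App.IH(2)[OF typing_App.prems]
  have ty: "typing \<Delta> (subst \<sigma> t) (TFun A B)" "typing \<Delta> (subst \<sigma> u) A"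
    using typing_App.hyps typing_App.prems by (auto intro: typing_subst)
  note c = \<open>c \<in> Obj C\<close>
  show ?case
    using typing_App.prems(2) sem_in[OF typing_App.hyps(1) c] sem_in[OF typing_App.hyps(2) c]
    by (simp add: sem_App[OF ty] sem_App[OF typing_App.hyps] ih c Comp_assoc Pairing_Comp
        cat_in ty_sem_in ctx_sem_in)
next
  case (typing_Tup \<Gamma> t A u B)
  note ih = typing_Tup.IH(1)[OF typing_Tup.prems] typing_Tup.IH(2)[OF typing_Tup.prems]
  have ty: "typing \<Delta> (subst \<sigma> t) A" "typing \<Delta> (subst \<sigma> u) B"
    using typing_Tup.hyps typing_Tup.prems by (auto intro: typing_subst)
  note c = \<open>c \<in> Obj C\<close>
  show ?case
    using typing_Tup.prems(2) sem_in[OF typing_Tup.hyps(1) c] sem_in[OF typing_Tup.hyps(2) c]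
    by (simp add: sem_Tup[OF ty] sem_Tup[OF typing_Tup.hyps] ih c Pairing_Comp
        cat_in ty_sem_in ctx_sem_in)
next
  case (typing_Pr1 \<Gamma> t A B)
  note ih = typing_Pr1.IH[OF typing_Pr1.prems]
  have ty: "typing \<Delta> (subst \<sigma> t) (TProd A B)"
    using typing_Pr1.hyps typing_Pr1.prems by (auto intro: typing_subst)
  note c = \<open>c \<in> Obj C\<close>
  show ?case
    using typing_Pr1.prems(2) sem_in[OF typing_Pr1.hyps(1) c]
    by (simp add: sem_Pr1[OF ty] sem_Pr1[OF typing_Pr1.hyps] ih c Comp_assoc
        cat_in ty_sem_in ctx_sem_in)
next
  case (typing_Pr2 \<Gamma> t A B)
  note ih = typing_Pr2.IH[OF typing_Pr2.prems]
  have ty: "typing \<Delta> (subst \<sigma> t) (TProd A B)"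
    using typing_Pr2.hyps typing_Pr2.prems by (auto intro: typing_subst)
  note c = \<open>c \<in> Obj C\<close>
  show ?case
    using typing_Pr2.prems(2) sem_in[OF typing_Pr2.hyps(1) c]
    by (simp add: sem_Pr2[OF ty] sem_Pr2[OF typing_Pr2.hyps] ih c Comp_assoc
        cat_in ty_sem_in ctx_sem_in)
next
  case (typing_Triv \<Gamma>)
  then have "Comp C (ctx_sem C c \<Delta>) (ctx_sem C c \<Gamma>) (One C) (Bang C (ctx_sem C c \<Gamma>)) m =
      Bang C (ctx_sem C c \<Delta>)"
    by (intro Bang_unique) (simp_all add: cat_in ctx_sem_in)
  then show ?case by simp
qed

lemma sem_beta_fun:
  assumes t: "typing (A # \<Gamma>) t B" and u: "typing \<Gamma> u A" and c: "c \<in> Obj C"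
  shows "sem C c \<Gamma> (App (Lam A t) u) = sem C c \<Gamma> (subst (case_nat u Var) t)"
proof -
  let ?g = "ctx_sem C c \<Gamma>" and ?a = "ty_sem C c A" and ?b = "ty_sem C c B"
  let ?e = "Exp C ?a ?b" and ?ga = "Prd C ?g ?a"
  let ?k = "Curry C ?g ?a ?b (sem C c (A # \<Gamma>) t)"
  let ?m = "Pairing C ?g ?g ?a (Id C ?g) (sem C c \<Gamma> u)"
  note o = ctx_sem_in[OF c] ty_sem_in[OF c]
  have st: "sem C c (A # \<Gamma>) t \<in> Hom C ?ga ?b" using sem_in[OF t c] by simp
  have su: "sem C c \<Gamma> u \<in> Hom C ?g ?a" using sem_in[OF u c] .
  have k: "?k \<in> Hom C ?g ?e" using st by (simp add: o cat_in)
  have m: "?m \<in> Hom C ?g ?ga" using su by (simp add: o cat_in)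
  have "sem C c \<Gamma> (subst (case_nat u Var) t) = Comp C ?g (ctx_sem C c (A # \<Gamma>)) ?b (sem C c (A # \<Gamma>) t) ?m"
  proof (rule sem_subst[OF t c])
    show "?m \<in> Hom C ?g (ctx_sem C c (A # \<Gamma>))" using m by simp
    fix i assume i: "i < length (A # \<Gamma>)"
    show "typing \<Gamma> (case_nat u Var i) ((A # \<Gamma>) ! i) \<and> sem C c \<Gamma> (case_nat u Var i) =
      Comp C ?g (ctx_sem C c (A # \<Gamma>)) (ty_sem C c ((A # \<Gamma>) ! i)) (var_sem C c (A # \<Gamma>) i) ?m"
    proof (cases i)
      case 0
      then show ?thesis using u su by (simp add: Snd_Pairing o cat_in)
    next
      case (Suc j)
      then have j: "j < length \<Gamma>" using i by simp
      show ?thesis using Suc j m su var_sem_in[OF c j]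
        by (simp add: Comp_assoc Fst_Pairing Id_right o cat_in typing.typing_Var)
    qed
  qed
  moreover have "Comp C ?g ?ga ?b (sem C c (A # \<Gamma>) t) ?m =
      Comp C ?g (Prd C ?e ?a) ?b (Eval C ?a ?b) (Pairing C ?g ?e ?a ?k (sem C c \<Gamma> u))"
  proof -
    let ?p = "Pairing C ?ga ?e ?a (Comp C ?ga ?g ?e ?k (Fst C ?g ?a)) (Snd C ?g ?a)"
    have p: "?p \<in> Hom C ?ga (Prd C ?e ?a)" using k by (simp add: o cat_in)
    have "Comp C ?g ?ga (Prd C ?e ?a) ?p ?m = Pairing C ?g ?e ?a ?k (sem C c \<Gamma> u)"
      using k m su by (simp add: Pairing_Comp Comp_assoc Fst_Pairing Snd_Pairing Id_right o cat_in)
    moreover have "Comp C ?ga (Prd C ?e ?a) ?b (Eval C ?a ?b) ?p = sem C c (A # \<Gamma>) t"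
      using Eval_Curry[OF _ _ _ st] by (simp add: o)
    moreover have "Comp C ?g ?ga ?b (Comp C ?ga (Prd C ?e ?a) ?b (Eval C ?a ?b) ?p) ?m =
        Comp C ?g (Prd C ?e ?a) ?b (Eval C ?a ?b) (Comp C ?g ?ga (Prd C ?e ?a) ?p ?m)"
      by (rule Comp_assoc) (use p m in \<open>simp_all add: o cat_in\<close>)
    ultimately show ?thesis by simp
  qed
  ultimately show ?thesis by (simp add: sem_App[OF typing.typing_Lam[OF t] u] sem_Lam[OF t])
qed

lemma sem_eta_fun:
  assumes t: "typing \<Gamma> t (TFun A B)" and c: "c \<in> Obj C"
  shows "sem C c \<Gamma> (Lam A (App (ren Suc t) (Var 0))) = sem C c \<Gamma> t"
proof -
  have v: "typing (A # \<Gamma>) (Var 0) A" using typing.typing_Var[of 0 "A # \<Gamma>"] by simp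
  note w = typing_weaken[OF t, of A]
  show ?thesis
    using Curry_unique[OF ctx_sem_in[OF c] ty_sem_in[OF c] ty_sem_in[OF c],
        of "sem C c \<Gamma> t" \<Gamma> A B, symmetric] sem_in[OF t c]
    by (simp add: sem_Lam[OF typing.typing_App[OF w v]] sem_App[OF w v] sem_weaken[OF t c])
qed

lemma sem_sound: "beta_eta \<Gamma> t u A \<Longrightarrow> c \<in> Obj C \<Longrightarrow> sem C c \<Gamma> t = sem C c \<Gamma> u"
proof (induction rule: beta_eta.induct)
  case (be_Lam A \<Gamma> t t' B)
  note ty = conjunct1[OF beta_eta_typing[OF be_Lam.hyps(1)]]
  note ty' = conjunct2[OF beta_eta_typing[OF be_Lam.hyps(1)]]
  show ?case using be_Lam.IH be_Lam.prems by (simp add: sem_Lam[OF ty] sem_Lam[OF ty'])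
next
  case (be_App \<Gamma> t t' A B u u')
  note ty = conjunct1[OF beta_eta_typing[OF be_App.hyps(1)]] conjunct1[OF beta_eta_typing[OF be_App.hyps(2)]]
  note ty' = conjunct2[OF beta_eta_typing[OF be_App.hyps(1)]] conjunct2[OF beta_eta_typing[OF be_App.hyps(2)]]
  show ?case using be_App.IH be_App.prems by (simp add: sem_App[OF ty] sem_App[OF ty'])
next
  case (be_Tup \<Gamma> t t' A u u' B)
  note ty = conjunct1[OF beta_eta_typing[OF be_Tup.hyps(1)]] conjunct1[OF beta_eta_typing[OF be_Tup.hyps(2)]]
  note ty' = conjunct2[OF beta_eta_typing[OF be_Tup.hyps(1)]] conjunct2[OF beta_eta_typing[OF be_Tup.hyps(2)]]
  show ?case using be_Tup.IH be_Tup.prems by (simp add: sem_Tup[OF ty] sem_Tup[OF ty'])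
next
  case (be_Pr1 \<Gamma> t t' A B)
  note ty = conjunct1[OF beta_eta_typing[OF be_Pr1.hyps(1)]]
  note ty' = conjunct2[OF beta_eta_typing[OF be_Pr1.hyps(1)]]
  show ?case using be_Pr1.IH be_Pr1.prems by (simp add: sem_Pr1[OF ty] sem_Pr1[OF ty'])
next
  case (be_Pr2 \<Gamma> t t' A B)
  note ty = conjunct1[OF beta_eta_typing[OF be_Pr2.hyps(1)]]
  note ty' = conjunct2[OF beta_eta_typing[OF be_Pr2.hyps(1)]]
  show ?case using be_Pr2.IH be_Pr2.prems by (simp add: sem_Pr2[OF ty] sem_Pr2[OF ty'])
next
  case (beta_fun A \<Gamma> t B u)
  then show ?case by (rule sem_beta_fun)
next
  case (eta_fun \<Gamma> t A B)
  then show ?case by (rule sem_eta_fun)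
next
  case (beta_fst \<Gamma> t A u B)
  then show ?case
    using sem_in[OF beta_fst.hyps(1)] sem_in[OF beta_fst.hyps(2)]
    by (simp add: sem_Pr1[OF typing.typing_Tup[OF beta_fst.hyps]] sem_Tup[OF beta_fst.hyps] Fst_Pairing ctx_sem_in ty_sem_in)
next
  case (beta_snd \<Gamma> t A u B)
  then show ?case
    using sem_in[OF beta_snd.hyps(1)] sem_in[OF beta_snd.hyps(2)]
    by (simp add: sem_Pr2[OF typing.typing_Tup[OF beta_snd.hyps]] sem_Tup[OF beta_snd.hyps] Snd_Pairing ctx_sem_in ty_sem_in)
next
  case (eta_prod \<Gamma> t A B)
  then show ?case
    using sem_in[OF eta_prod.hyps]
    by (simp add: Pairing_unique[symmetric] sem_Tup[OF typing.typing_Pr1[OF eta_prod.hyps] typing.typing_Pr2[OF eta_prod.hyps]]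
        sem_Pr1[OF eta_prod.hyps] sem_Pr2[OF eta_prod.hyps] ctx_sem_in ty_sem_in)
next
  case (eta_unit \<Gamma> t)
  then show ?case using sem_in[OF eta_unit.hyps] by (simp add: Bang_unique ctx_sem_in)
qed auto

lemma interp_eq:
  assumes "T \<in> Tm A" "t \<in> T" "c \<in> Obj C"
  shows "interp C c T = sem C c [] t"
proof -
  have "beta_eta [] t u A" if "u \<in> T" for u
    using quotient_eq_iff[OF equiv_beta_eta, of T A T t u] assms that unfolding Tm_def by simp
  then have eq: "sem C c [] u = sem C c [] t" if "u \<in> T" for u
    using that assms(3) sem_sound by metis
  show ?thesis
    unfolding interp_def by (rule the_elem_image_unique[OF _ eq]) (use assms(2) in blast)
qed

lemma interp_in:
  assumes "T \<in> Tm A" "c \<in> Obj C"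
  shows "interp C c T \<in> Hom C (One C) (ty_sem C c A)"
proof -
  obtain t where t: "typing [] t A" "T = {(t, u). beta_eta [] t u A} `` {t}"
    using assms(1) unfolding Tm_def by (auto elim!: quotientE)
  then have "t \<in> T" by (auto intro: be_refl)
  then show ?thesis using interp_eq[OF assms(1) _ assms(2)] sem_in[OF t(1) assms(2)] by simp
qed

end

section \<open>The category of finite sets\<close>

text \<open>The elements of the finite sets are drawn from a countably infinite type that is closed under
  pairs and graphs of functions between finite sets; thus every finite set is, up to bijection, an
  object of \<open>FinSet\<close>, and all the structure is the set-theoretic one.  Morphisms are the extensional
  functions.\<close>

datatype elt = Atom nat | Star | EPair elt elt | EGraph "(elt \<times> elt) fset"

definition graph :: "elt set \<Rightarrow> (elt \<Rightarrow> elt) \<Rightarrow> elt" where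
  "graph X f = EGraph (Abs_fset ((\<lambda>x. (x, f x)) ` X))"

primrec efst :: "elt \<Rightarrow> elt" where "efst (EPair x y) = x"
primrec esnd :: "elt \<Rightarrow> elt" where "esnd (EPair x y) = y"
primrec eapp :: "elt \<Rightarrow> elt \<Rightarrow> elt" where "eapp (EGraph G) x = (THE y. (x, y) \<in> fset G)"

definition FinSet :: "(elt set, elt \<Rightarrow> elt) cat" where
  "FinSet = \<lparr>
    Obj = {X. finite X},
    Hom = (\<lambda>X Y. X \<rightarrow>\<^sub>E Y),
    Id = (\<lambda>X. \<lambda>x\<in>X. x),
    Comp = (\<lambda>X Y Z g f. compose X g f),
    One = {Star},
    Bang = (\<lambda>X. \<lambda>x\<in>X. Star),
    Prd = (\<lambda>X Y. {EPair x y | x y. x \<in> X \<and> y \<in> Y}),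
    Fst = (\<lambda>X Y. \<lambda>p\<in>{EPair x y | x y. x \<in> X \<and> y \<in> Y}. efst p),
    Snd = (\<lambda>X Y. \<lambda>p\<in>{EPair x y | x y. x \<in> X \<and> y \<in> Y}. esnd p),
    Pairing = (\<lambda>Z X Y f g. \<lambda>z\<in>Z. EPair (f z) (g z)),
    Exp = (\<lambda>X Y. {graph X f | f. f \<in> X \<rightarrow>\<^sub>E Y}),
    Eval = (\<lambda>X Y. \<lambda>p\<in>{EPair (graph X f) x | f x. f \<in> X \<rightarrow>\<^sub>E Y \<and> x \<in> X}. eapp (efst p) (esnd p)),
    Curry = (\<lambda>Z X Y f. \<lambda>z\<in>Z. graph X (\<lambda>x\<in>X. f (EPair z x)))\<rparr>"

lemma eapp_graph: "finite X \<Longrightarrow> x \<in> X \<Longrightarrow> eapp (graph X f) x = f x"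
  by (auto simp: graph_def Abs_fset_inverse)

lemma graph_inj:
  assumes "finite X" "f \<in> X \<rightarrow>\<^sub>E Y" "g \<in> X \<rightarrow>\<^sub>E Y'" "graph X f = graph X g"
  shows "f = g"
proof
  fix x
  show "f x = g x"
  proof (cases "x \<in> X")
    case True
    then show ?thesis using assms(1,4) by (metis eapp_graph)
  next
    case False
    then show ?thesis using assms(2,3) by (simp add: PiE_def extensional_def)
  qed
qed

lemma graph_cong: "(\<And>x. x \<in> X \<Longrightarrow> f x = g x) \<Longrightarrow> graph X f = graph X g"
  unfolding graph_def by (metis (mono_tags, lifting) image_cong)

lemma finite_graphs: "finite X \<Longrightarrow> finite Y \<Longrightarrow> finite {graph X f | f. f \<in> X \<rightarrow>\<^sub>E Y}"
  by (simp add: setcompr_eq_image finite_PiE)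

lemma EPair_graph_mem: "{EPair (graph X f) x | f x. f \<in> X \<rightarrow>\<^sub>E Y \<and> x \<in> X} =
    {EPair g x | g x. g \<in> {graph X f | f. f \<in> X \<rightarrow>\<^sub>E Y} \<and> x \<in> X}"
  by blast

lemma cartesian_closed_FinSet: "cartesian_closed FinSet"
proof
  fix a b c d f g h
  let ?C = FinSet
  show "Id ?C a \<in> Hom ?C a a"
    by (auto simp: FinSet_def)
  show "f \<in> Hom ?C a b \<Longrightarrow> g \<in> Hom ?C b c \<Longrightarrow> Comp ?C a b c g f \<in> Hom ?C a c"
    by (auto simp: FinSet_def compose_def)
  show "f \<in> Hom ?C a b \<Longrightarrow> Comp ?C a b b (Id ?C b) f = f"
    by (auto simp: FinSet_def compose_def fun_eq_iff PiE_def Pi_def extensional_def)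
  show "f \<in> Hom ?C a b \<Longrightarrow> Comp ?C a a b f (Id ?C a) = f"
    by (auto simp: FinSet_def compose_def fun_eq_iff PiE_def Pi_def extensional_def)
  show "f \<in> Hom ?C a b \<Longrightarrow> g \<in> Hom ?C b c \<Longrightarrow> h \<in> Hom ?C c d \<Longrightarrow>
      Comp ?C a b d (Comp ?C b c d h g) f = Comp ?C a c d h (Comp ?C a b c g f)"
    by (auto simp: FinSet_def compose_def fun_eq_iff PiE_def Pi_def)
  show "One ?C \<in> Obj ?C"
    by (simp add: FinSet_def)
  show "Bang ?C a \<in> Hom ?C a (One ?C)"
    by (auto simp: FinSet_def)
  show "f \<in> Hom ?C a (One ?C) \<Longrightarrow> f = Bang ?C a"
    by (auto simp: FinSet_def PiE_def Pi_def extensional_def fun_eq_iff)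
  show "a \<in> Obj ?C \<Longrightarrow> b \<in> Obj ?C \<Longrightarrow> Prd ?C a b \<in> Obj ?C"
    by (simp add: FinSet_def finite_image_set2)
  show "Fst ?C a b \<in> Hom ?C (Prd ?C a b) a"
    by (auto simp: FinSet_def)
  show "Snd ?C a b \<in> Hom ?C (Prd ?C a b) b"
    by (auto simp: FinSet_def)
  show "f \<in> Hom ?C c a \<Longrightarrow> g \<in> Hom ?C c b \<Longrightarrow> Pairing ?C c a b f g \<in> Hom ?C c (Prd ?C a b)"
    by (auto simp: FinSet_def)
  show "f \<in> Hom ?C c a \<Longrightarrow> g \<in> Hom ?C c b \<Longrightarrow>
      Comp ?C c (Prd ?C a b) a (Fst ?C a b) (Pairing ?C c a b f g) = f"
    by (auto simp: FinSet_def compose_def fun_eq_iff PiE_def Pi_def extensional_def)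
  show "f \<in> Hom ?C c a \<Longrightarrow> g \<in> Hom ?C c b \<Longrightarrow>
      Comp ?C c (Prd ?C a b) b (Snd ?C a b) (Pairing ?C c a b f g) = g"
    by (auto simp: FinSet_def compose_def fun_eq_iff PiE_def Pi_def extensional_def)
  show "h \<in> Hom ?C c (Prd ?C a b) \<Longrightarrow>
      h = Pairing ?C c a b (Comp ?C c (Prd ?C a b) a (Fst ?C a b) h)
            (Comp ?C c (Prd ?C a b) b (Snd ?C a b) h)"
    by (fastforce simp: FinSet_def compose_def fun_eq_iff PiE_def Pi_def extensional_def)
  show "a \<in> Obj ?C \<Longrightarrow> b \<in> Obj ?C \<Longrightarrow> Exp ?C a b \<in> Obj ?C"
    by (simp add: FinSet_def finite_graphs)
  show "a \<in> Obj ?C \<Longrightarrow> b \<in> Obj ?C \<Longrightarrow> Eval ?C a b \<in> Hom ?C (Prd ?C (Exp ?C a b) a) b"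
    by (auto simp: FinSet_def EPair_graph_mem eapp_graph)
  have part: "(\<lambda>x\<in>a. f (EPair z x)) \<in> a \<rightarrow>\<^sub>E b" if "f \<in> Hom ?C (Prd ?C c a) b" "z \<in> c" for z
    using that by (auto simp: FinSet_def PiE_def Pi_def)
  show "Curry ?C c a b f \<in> Hom ?C c (Exp ?C a b)" if "f \<in> Hom ?C (Prd ?C c a) b"
  proof -
    have "(\<lambda>z\<in>c. graph a (\<lambda>x\<in>a. f (EPair z x))) \<in> c \<rightarrow>\<^sub>E {graph a k | k. k \<in> a \<rightarrow>\<^sub>E b}"
      using part[OF that] by (subst restrict_PiE_iff) blast
    then show ?thesis by (simp add: FinSet_def)
  qed
  have ev: "Eval ?C a b (EPair (graph a k) x) = k x"
    if "a \<in> Obj ?C" "k \<in> Hom ?C a b" "x \<in> a" for k x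
  proof -
    have "EPair (graph a k) x \<in> {EPair (graph a f) x | f x. f \<in> a \<rightarrow>\<^sub>E b \<and> x \<in> a}"
      using that by (auto simp: FinSet_def)
    then show ?thesis using that by (simp add: FinSet_def eapp_graph)
  qed
  have pr: "Comp ?C (Prd ?C c a) (Prd ?C (Exp ?C a b) a) b (Eval ?C a b)
      (Pairing ?C (Prd ?C c a) (Exp ?C a b) a
        (Comp ?C (Prd ?C c a) c (Exp ?C a b) k (Fst ?C c a)) (Snd ?C c a)) (EPair z x) =
      Eval ?C a b (EPair (k z) x)" if "z \<in> c" "x \<in> a" for k z x
    using that by (auto simp: FinSet_def compose_def)
  have ext: "Comp ?C (Prd ?C c a) Y Z k l \<in> extensional (Prd ?C c a)" for Y Z k l
    by (simp add: FinSet_def compose_def)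
  have Prd: "p \<in> Prd ?C c a \<Longrightarrow> \<exists>z x. p = EPair z x \<and> z \<in> c \<and> x \<in> a" for p
    by (auto simp: FinSet_def)
  show "Comp ?C (Prd ?C c a) (Prd ?C (Exp ?C a b) a) b (Eval ?C a b)
      (Pairing ?C (Prd ?C c a) (Exp ?C a b) a
        (Comp ?C (Prd ?C c a) c (Exp ?C a b) (Curry ?C c a b f) (Fst ?C c a)) (Snd ?C c a)) = f"
    if a: "a \<in> Obj ?C" and f: "f \<in> Hom ?C (Prd ?C c a) b"
  proof (rule extensionalityI[OF ext])
    show "f \<in> extensional (Prd ?C c a)" using f by (simp add: FinSet_def PiE_def)
    fix p assume "p \<in> Prd ?C c a"
    then obtain z x where p: "p = EPair z x" "z \<in> c" "x \<in> a" using Prd by blast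
    have "(\<lambda>x\<in>a. f (EPair z x)) \<in> Hom ?C a b"
      using part[OF f p(2)] by (simp add: FinSet_def)
    then have "Eval ?C a b (EPair (graph a (\<lambda>x\<in>a. f (EPair z x))) x) = f p"
      using ev[OF a] p by simp
    moreover have "Curry ?C c a b f z = graph a (\<lambda>x\<in>a. f (EPair z x))"
      using p by (simp add: FinSet_def)
    ultimately show "Comp ?C (Prd ?C c a) (Prd ?C (Exp ?C a b) a) b (Eval ?C a b)
      (Pairing ?C (Prd ?C c a) (Exp ?C a b) a
        (Comp ?C (Prd ?C c a) c (Exp ?C a b) (Curry ?C c a b f) (Fst ?C c a)) (Snd ?C c a)) p = f p"
      using pr p by simp
  qed
  show "g = Curry ?C c a b (Comp ?C (Prd ?C c a) (Prd ?C (Exp ?C a b) a) b (Eval ?C a b)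
      (Pairing ?C (Prd ?C c a) (Exp ?C a b) a
        (Comp ?C (Prd ?C c a) c (Exp ?C a b) g (Fst ?C c a)) (Snd ?C c a)))"
    (is "g = Curry ?C c a b ?u")
    if a: "a \<in> Obj ?C" and g: "g \<in> Hom ?C c (Exp ?C a b)"
  proof (rule extensionalityI[where A = c])
    show "g \<in> extensional c" using g by (simp add: FinSet_def PiE_def)
    show "Curry ?C c a b ?u \<in> extensional c" by (simp add: FinSet_def)
    fix z assume z: "z \<in> c"
    then have "g z \<in> {graph a f | f. f \<in> a \<rightarrow>\<^sub>E b}"
      using g by (auto simp: FinSet_def)
    then obtain k where k: "g z = graph a k" "k \<in> a \<rightarrow>\<^sub>E b" by blast
    have "?u (EPair z x) = k x" if "x \<in> a" for x
      using pr[OF z that, of g] ev[OF a, of k] k that by (simp add: FinSet_def)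
    then have "graph a k = graph a (\<lambda>x\<in>a. ?u (EPair z x))"
      by (intro graph_cong) simp
    moreover have "Curry ?C c a b ?u z = graph a (\<lambda>x\<in>a. ?u (EPair z x))"
      using z unfolding FinSet_def by simp
    ultimately show "g z = Curry ?C c a b ?u z" using k by simp
  qed
qed

lemma well_pointed_FinSet: "well_pointed FinSet"
  unfolding well_pointed_def
proof (intro ballI impI)
  fix a b f g
  assume f: "f \<in> Hom FinSet a b" and g: "g \<in> Hom FinSet a b"
    and eq: "\<forall>x\<in>Hom FinSet (One FinSet) a.
      Comp FinSet (One FinSet) a b f x = Comp FinSet (One FinSet) a b g x"
  show "f = g"
  proof (rule extensionalityI[where A = a])
    show "f \<in> extensional a" "g \<in> extensional a" using f g by (simp_all add: FinSet_def PiE_def)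
    fix x assume "x \<in> a"
    then have "(\<lambda>_\<in>{Star}. x) \<in> Hom FinSet (One FinSet) a" by (auto simp: FinSet_def)
    with eq have "compose {Star} f (\<lambda>_\<in>{Star}. x) = compose {Star} g (\<lambda>_\<in>{Star}. x)"
      by (simp add: FinSet_def)
    from fun_cong[OF this, of Star] show "f x = g x" by (simp add: compose_def)
  qed
qed

lemma locally_finite_FinSet: "locally_finite FinSet"
  by (auto simp: locally_finite_def FinSet_def intro: finite_PiE)

text \<open>The element of \<open>X\<close> identified with a point \<open>1 \<rightarrow> X\<close> of \<open>FinSet\<close>.\<close>

definition point_elt :: "(elt \<Rightarrow> elt) \<Rightarrow> elt" where
  "point_elt x = x Star"

lemma bij_betw_point_elt: "bij_betw point_elt (Hom FinSet (One FinSet) X) X"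
proof -
  have hom: "Hom FinSet (One FinSet) X = {Star} \<rightarrow>\<^sub>E X" by (simp add: FinSet_def)
  show ?thesis
    unfolding hom
  proof (rule bij_betw_byWitness[where f' = "\<lambda>y. \<lambda>_\<in>{Star}. y"])
    show "\<forall>x\<in>{Star} \<rightarrow>\<^sub>E X. (\<lambda>_\<in>{Star}. point_elt x) = x"
      by (auto simp: point_elt_def fun_eq_iff PiE_def extensional_def)
    show "\<forall>y\<in>X. point_elt (\<lambda>_\<in>{Star}. y) = y"
      by (simp add: point_elt_def)
    show "point_elt ` ({Star} \<rightarrow>\<^sub>E X) \<subseteq> X"
      by (auto simp: point_elt_def PiE_def Pi_def)
    show "(\<lambda>y. \<lambda>_\<in>{Star}. y) ` X \<subseteq> {Star} \<rightarrow>\<^sub>E X"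
      by (simp add: image_subset_iff)
  qed
qed

end

theory Submission
  imports Defs
begin

text \<open>
  Take for \<open>Q\<close> a copy of the finite set of points of \<open>e\<close>, and extend the bijection between
  \<open>Q\<close> and \<open>E(1, e)\<close> to a logical relation between points of the two interpretations.  At every type
  it is a partial surjection from the points in \<open>FinSet\<close> to the points in \<open>E\<close>: it is functional
  because \<open>E\<close> is well-pointed, and surjective because every function between finite sets is a
  morphism.  The delicate point is surjectivity at \<open>A \<rightarrow> B\<close>, where a function has to be given some
  value outside the domain of the relation at \<open>A\<close>: this needs that \<open>A\<close> is empty in \<open>FinSet\<close> as soon
  as \<open>B\<close> is empty there and \<open>A \<rightarrow> B\<close> is inhabited in \<open>E\<close>.  It holds because in every cartesian
  closed category a type built from one object \<open>c\<close> has a point or a morphism to \<open>c\<close>, and which of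
  the two is decided by evaluating the type as a Boolean formula with \<open>c\<close> false.
\<close>

section \<open>Points of exponentials\<close>

context cartesian_closed
begin

definition app_pt :: "'o \<Rightarrow> 'o \<Rightarrow> 'm \<Rightarrow> 'm \<Rightarrow> 'm" where
  "app_pt a b f x = Comp C (One C) (Prd C (Exp C a b) a) b (Eval C a b)
     (Pairing C (One C) (Exp C a b) a f x)"

lemma app_pt_in:
  assumes "a \<in> Obj C" "b \<in> Obj C" "f \<in> Hom C (One C) (Exp C a b)" "x \<in> Hom C (One C) a"
  shows "app_pt a b f x \<in> Hom C (One C) b"
  unfolding app_pt_def using assms by (auto intro!: cat_in)

text \<open>The left side has the shape that \<open>sem_App\<close> gives to an application, here
  evaluated at a point of the context.\<close>

lemma Comp_Eval_Pairing_pt: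
  assumes "g \<in> Obj C" "a \<in> Obj C" "b \<in> Obj C" "t \<in> Hom C g (Exp C a b)" "u \<in> Hom C g a"
    "p \<in> Hom C (One C) g"
  shows "Comp C (One C) g b (Comp C g (Prd C (Exp C a b) a) b (Eval C a b)
      (Pairing C g (Exp C a b) a t u)) p =
    app_pt a b (Comp C (One C) g (Exp C a b) t p) (Comp C (One C) g a u p)"
  unfolding app_pt_def using assms by (simp add: Comp_assoc Pairing_Comp cat_in)

lemma Pairing_Fst_Snd_pt:
  assumes "g \<in> Obj C" "a \<in> Obj C" "e \<in> Obj C" "k \<in> Hom C g e" "p \<in> Hom C (One C) g"
    "x \<in> Hom C (One C) a"
  shows "Comp C (One C) (Prd C g a) (Prd C e a)
      (Pairing C (Prd C g a) e a (Comp C (Prd C g a) g e k (Fst C g a)) (Snd C g a))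
      (Pairing C (One C) g a p x) =
    Pairing C (One C) e a (Comp C (One C) g e k p) x"
  using assms by (simp add: Pairing_Comp Comp_assoc Fst_Pairing Snd_Pairing cat_in)

text \<open>The beta law on points: compose \<open>Eval_Curry\<close> with the point of the product
  given by \<open>p\<close> and \<open>x\<close>. It serves the abstraction case of
  \<open>lrel_sem\<close>.\<close>

lemma app_pt_Curry:
  assumes "g \<in> Obj C" "a \<in> Obj C" "b \<in> Obj C" "f \<in> Hom C (Prd C g a) b"
    "p \<in> Hom C (One C) g" "x \<in> Hom C (One C) a"
  shows "app_pt a b (Comp C (One C) g (Exp C a b) (Curry C g a b f) p) x =
    Comp C (One C) (Prd C g a) b f (Pairing C (One C) g a p x)"
proof -
  let ?e = "Exp C a b" and ?ga = "Prd C g a"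
  let ?q = "Pairing C ?ga ?e a (Comp C ?ga g ?e (Curry C g a b f) (Fst C g a)) (Snd C g a)"
  let ?m = "Pairing C (One C) g a p x"
  have q: "?q \<in> Hom C ?ga (Prd C ?e a)" using assms by (auto intro!: cat_in)
  have m: "?m \<in> Hom C (One C) ?ga" using assms by (auto intro!: cat_in)
  have "Comp C (One C) ?ga b f ?m =
      Comp C (One C) ?ga b (Comp C ?ga (Prd C ?e a) b (Eval C a b) ?q) ?m"
    using Eval_Curry[OF assms(1-4)] by simp
  also have "\<dots> = Comp C (One C) (Prd C ?e a) b (Eval C a b) (Comp C (One C) ?ga (Prd C ?e a) ?q ?m)"
    by (rule Comp_assoc) (use assms q m in \<open>auto intro!: cat_in\<close>)
  also have "Comp C (One C) ?ga (Prd C ?e a) ?q ?m =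
      Pairing C (One C) ?e a (Comp C (One C) g ?e (Curry C g a b f) p) x"
    by (rule Pairing_Fst_Snd_pt) (use assms in \<open>auto intro!: cat_in\<close>)
  finally show ?thesis by (simp add: app_pt_def)
qed

text \<open>Uncurrying turns both points into morphisms from \<open>Prd C (One C) a\<close> to
  \<open>b\<close>. Those agree on all points, hence are equal, and currying gives the
  claim.\<close>

lemma app_pt_ext:
  assumes "well_pointed C" "a \<in> Obj C" "b \<in> Obj C"
    and h: "h \<in> Hom C (One C) (Exp C a b)" and h': "h' \<in> Hom C (One C) (Exp C a b)"
    and eq: "\<And>x. x \<in> Hom C (One C) a \<Longrightarrow> app_pt a b h x = app_pt a b h' x"
  shows "h = h'"
proof -
  let ?e = "Exp C a b" and ?i = "One C"
  let ?l = "Prd C ?i a"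
  \<comment> \<open>The uncurried \<open>k\<close>, in exactly the form whose \<open>Curry\<close>
    is \<open>k\<close> by \<open>Curry_unique\<close>.\<close>
  define u where "u k = Comp C ?l (Prd C ?e a) b (Eval C a b)
    (Pairing C ?l ?e a (Comp C ?l ?i ?e k (Fst C ?i a)) (Snd C ?i a))" for k
  have u_in: "u k \<in> Hom C ?l b" if "k \<in> Hom C ?i ?e" for k
    unfolding u_def using assms(2,3) that by (auto intro!: cat_in)
  have u_pt: "Comp C ?i ?l b (u k) p = app_pt a b k (Comp C ?i ?l a (Snd C ?i a) p)"
    if k: "k \<in> Hom C ?i ?e" and p: "p \<in> Hom C ?i ?l" for k p
  proof -
    \<comment> \<open>A point of \<open>Prd C (One C) a\<close> is determined by its second
      component, since the first is the only endomorphism of \<open>One C\<close>.\<close>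
    have "Comp C ?i ?l ?i (Fst C ?i a) p = Id C ?i"
    proof -
      have "Comp C ?i ?l ?i (Fst C ?i a) p \<in> Hom C ?i ?i"
        using assms(2,3) p by (auto intro!: cat_in)
      then show ?thesis
        using Bang_unique[OF One_in] Id_in[OF One_in] by metis
    qed
    then have "Comp C ?i ?l ?e (Comp C ?l ?i ?e k (Fst C ?i a)) p = k"
      using assms(2,3) k p by (simp add: Comp_assoc Id_right cat_in)
    then show ?thesis
      unfolding u_def using assms(2,3) k p by (simp add: Comp_Eval_Pairing_pt cat_in)
  qed
  have "u h = u h'"
  proof -
    have "Comp C ?i ?l b (u h) p = Comp C ?i ?l b (u h') p" if "p \<in> Hom C ?i ?l" for p
      using assms(2,3) h h' that by (simp add: u_pt eq cat_in)
    moreover have "?l \<in> Obj C" using assms(2) by (simp add: cat_in)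
    ultimately show ?thesis
      using assms(1,3) u_in[OF h] u_in[OF h'] unfolding well_pointed_def by blast
  qed
  then show ?thesis
    using Curry_unique[OF One_in assms(2,3) h] Curry_unique[OF One_in assms(2,3) h']
    unfolding u_def by simp
qed

end

section \<open>Inhabitation of types\<close>

text \<open>The truth value mentions no category, so it can carry inhabitation from one
  interpretation to the other.\<close>

primrec inhabited :: "ty \<Rightarrow> bool" where
  "inhabited TBase \<longleftrightarrow> False"
| "inhabited (TFun A B) \<longleftrightarrow> (inhabited A \<longrightarrow> inhabited B)"
| "inhabited (TProd A B) \<longleftrightarrow> inhabited A \<and> inhabited B"
| "inhabited TUnit \<longleftrightarrow> True"

context cartesian_closed
begin

lemma Hom_nonempty_trans:
  assumes "Hom C a b \<noteq> {}" "Hom C b c \<noteq> {}" "a \<in> Obj C" "b \<in> Obj C" "c \<in> Obj C"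
  shows "Hom C a c \<noteq> {}"
  using assms Comp_in by blast

lemma Hom_Prd_nonempty:
  assumes "Hom C c a \<noteq> {}" "Hom C c b \<noteq> {}" "a \<in> Obj C" "b \<in> Obj C" "c \<in> Obj C"
  shows "Hom C c (Prd C a b) \<noteq> {}"
  using assms Pairing_in by blast

text \<open>Compose the given morphism with the matching projection of \<open>Prd C c a\<close>,
  then curry.\<close>

lemma Hom_Exp_nonempty:
  assumes "Hom C a b \<noteq> {} \<or> Hom C c b \<noteq> {}" "a \<in> Obj C" "b \<in> Obj C" "c \<in> Obj C"
  shows "Hom C c (Exp C a b) \<noteq> {}"
proof -
  have "Hom C (Prd C c a) b \<noteq> {}"
    using assms Hom_nonempty_trans[of "Prd C c a" _ b] Fst_in[of c a] Snd_in[of c a] Prd_in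
    by blast
  then show ?thesis using assms Curry_in by blast
qed

text \<open>With morphisms read as entailments and \<open>c\<close> as falsehood, this is ex falso;
  at function types a constant map into the codomain does it.\<close>

lemma Hom_base_ty_nonempty: "c \<in> Obj C \<Longrightarrow> Hom C c (ty_sem C c A) \<noteq> {}"
proof (induction A)
  case TBase
  then show ?case using Id_in by auto
next
  case (TFun A B)
  then show ?case using Hom_Exp_nonempty ty_sem_in by simp
next
  case (TProd A B)
  then show ?case using Hom_Prd_nonempty ty_sem_in by simp
next
  case TUnit
  then show ?case using Bang_in by auto
qed

text \<open>True types are entailed by \<open>One C\<close> and false ones entail \<open>c\<close>.
  For a true implication either the codomain has a point or the domain maps to \<open>c\<close> and
  from there to the codomain.\<close>

lemma inhabited_dichotomy:
  assumes c: "c \<in> Obj C"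
  shows "if inhabited A then Hom C (One C) (ty_sem C c A) \<noteq> {} else Hom C (ty_sem C c A) c \<noteq> {}"
proof (induction A)
  case TBase
  then show ?case using c Id_in by auto
next
  case (TFun A B)
  let ?a = "ty_sem C c A" and ?b = "ty_sem C c B"
  note o = c ty_sem_in[OF c, of A] ty_sem_in[OF c, of B] One_in
  show ?case
  proof (cases "inhabited (TFun A B)")
    case True
    then have "Hom C ?a ?b \<noteq> {} \<or> Hom C (One C) ?b \<noteq> {}"
      using TFun o Hom_nonempty_trans[OF _ Hom_base_ty_nonempty[OF c]] by (auto split: if_splits)
    then show ?thesis using True o Hom_Exp_nonempty by simp
  next
    case False
    then have a: "Hom C (One C) ?a \<noteq> {}" and b: "Hom C ?b c \<noteq> {}"
      using TFun by auto
    let ?e = "Exp C ?a ?b"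
    have e: "?e \<in> Obj C" "Prd C ?e ?a \<in> Obj C" using o by (auto intro!: cat_in)
    \<comment> \<open>Evaluation at a fixed point of \<open>?a\<close> maps \<open>?e\<close> to
      \<open>?b\<close>, and \<open>?b\<close> maps to \<open>c\<close>.\<close>
    have "Hom C ?e ?a \<noteq> {}" using a e o Bang_in Hom_nonempty_trans[of ?e "One C"] by blast
    then have "Hom C ?e (Prd C ?e ?a) \<noteq> {}"
      using Hom_Prd_nonempty e o Id_in by blast
    moreover have "Hom C (Prd C ?e ?a) ?b \<noteq> {}" using Eval_in o by blast
    ultimately have "Hom C ?e c \<noteq> {}"
      using b e o Hom_nonempty_trans by meson
    then show ?thesis using False by simp
  qed
next
  case (TProd A B)
  let ?a = "ty_sem C c A" and ?b = "ty_sem C c B"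
  note o = c ty_sem_in[OF c, of A] ty_sem_in[OF c, of B] One_in
  show ?case
  proof (cases "inhabited (TProd A B)")
    case True
    then show ?thesis using TProd o Hom_Prd_nonempty by simp
  next
    case False
    then have "Hom C ?a c \<noteq> {} \<or> Hom C ?b c \<noteq> {}" using TProd by auto
    then have "Hom C (Prd C ?a ?b) c \<noteq> {}"
      using o Hom_nonempty_trans[of "Prd C ?a ?b" _ c] Fst_in Snd_in Prd_in by blast
    then show ?thesis using False by auto
  qed
next
  case TUnit
  then show ?case using Id_in One_in by auto
qed

text \<open>A point of a false type yields a point of \<open>c\<close> by the dichotomy; conversely
  \<open>c\<close> maps to every type.\<close>

lemma ty_pt_nonempty_iff:
  assumes c: "c \<in> Obj C"
  shows "Hom C (One C) (ty_sem C c A) \<noteq> {} \<longleftrightarrow> inhabited A \<or> Hom C (One C) c \<noteq> {}"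
  using inhabited_dichotomy[OF c, of A] Hom_base_ty_nonempty[OF c, of A]
    Hom_nonempty_trans[of "One C" "ty_sem C c A" c] Hom_nonempty_trans[of "One C" c "ty_sem C c A"]
    ty_sem_in[OF c, of A] One_in c
  by (auto split: if_splits)

end

section \<open>Logical relations between two cartesian closed categories\<close>

text \<open>The main proof takes \<open>FinSet\<close> for \<open>C\<close> and \<open>E\<close> for
  \<open>D\<close>, so the partial surjection runs from \<open>C\<close> to
  \<open>D\<close>.\<close>

locale base_relation = C: cartesian_closed C + D: cartesian_closed D
  for C :: "('o, 'm) cat" and D :: "('p, 'n) cat" +
  fixes c :: 'o and d :: 'p and R :: "'m \<Rightarrow> 'n \<Rightarrow> bool"
  assumes c: "c \<in> Obj C" and d: "d \<in> Obj D"
begin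

lemmas objs = C.ty_sem_in[OF c] C.ctx_sem_in[OF c] D.ty_sem_in[OF d] D.ctx_sem_in[OF d]
  C.One_in D.One_in

abbreviation cpts :: "ty \<Rightarrow> 'm set" where
  "cpts A \<equiv> Hom C (One C) (ty_sem C c A)"

abbreviation dpts :: "ty \<Rightarrow> 'n set" where
  "dpts A \<equiv> Hom D (One D) (ty_sem D d A)"

abbreviation capp :: "ty \<Rightarrow> ty \<Rightarrow> 'm \<Rightarrow> 'm \<Rightarrow> 'm" where
  "capp A B \<equiv> C.app_pt (ty_sem C c A) (ty_sem C c B)"

abbreviation dapp :: "ty \<Rightarrow> ty \<Rightarrow> 'n \<Rightarrow> 'n \<Rightarrow> 'n" where
  "dapp A B \<equiv> D.app_pt (ty_sem D d A) (ty_sem D d B)"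

primrec lrel :: "ty \<Rightarrow> 'm \<Rightarrow> 'n \<Rightarrow> bool" where
  "lrel TBase x y \<longleftrightarrow> x \<in> cpts TBase \<and> y \<in> dpts TBase \<and> R x y"
| "lrel (TFun A B) x y \<longleftrightarrow> x \<in> cpts (TFun A B) \<and> y \<in> dpts (TFun A B) \<and>
    (\<forall>u v. lrel A u v \<longrightarrow> lrel B (capp A B x u) (dapp A B y v))"
| "lrel (TProd A B) x y \<longleftrightarrow> x \<in> cpts (TProd A B) \<and> y \<in> dpts (TProd A B) \<and>
    lrel A (Comp C (One C) (Prd C (ty_sem C c A) (ty_sem C c B)) (ty_sem C c A)
              (Fst C (ty_sem C c A) (ty_sem C c B)) x)
           (Comp D (One D) (Prd D (ty_sem D d A) (ty_sem D d B)) (ty_sem D d A)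
              (Fst D (ty_sem D d A) (ty_sem D d B)) y) \<and>
    lrel B (Comp C (One C) (Prd C (ty_sem C c A) (ty_sem C c B)) (ty_sem C c B)
              (Snd C (ty_sem C c A) (ty_sem C c B)) x)
           (Comp D (One D) (Prd D (ty_sem D d A) (ty_sem D d B)) (ty_sem D d B)
              (Snd D (ty_sem D d A) (ty_sem D d B)) y)"
| "lrel TUnit x y \<longleftrightarrow> x \<in> cpts TUnit \<and> y \<in> dpts TUnit"

text \<open>Relatedness is tested variable by variable rather than by recursion on the context,
  which makes the variable case of \<open>lrel_sem\<close> immediate.\<close>

definition ctx_rel :: "ty list \<Rightarrow> 'm \<Rightarrow> 'n \<Rightarrow> bool" where
  "ctx_rel \<Gamma> p q \<longleftrightarrow> p \<in> Hom C (One C) (ctx_sem C c \<Gamma>) \<and> q \<in> Hom D (One D) (ctx_sem D d \<Gamma>) \<and>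
    (\<forall>i < length \<Gamma>. lrel (\<Gamma> ! i)
      (Comp C (One C) (ctx_sem C c \<Gamma>) (ty_sem C c (\<Gamma> ! i)) (var_sem C c \<Gamma> i) p)
      (Comp D (One D) (ctx_sem D d \<Gamma>) (ty_sem D d (\<Gamma> ! i)) (var_sem D d \<Gamma> i) q))"

lemma lrel_pts: "lrel A x y \<Longrightarrow> x \<in> cpts A \<and> y \<in> dpts A"
  by (cases A) auto

lemma ctx_rel_Cons:
  assumes pq: "ctx_rel \<Gamma> p q" and xy: "lrel A x y"
  shows "ctx_rel (A # \<Gamma>) (Pairing C (One C) (ctx_sem C c \<Gamma>) (ty_sem C c A) p x)
    (Pairing D (One D) (ctx_sem D d \<Gamma>) (ty_sem D d A) q y)"
proof -
  have p: "p \<in> Hom C (One C) (ctx_sem C c \<Gamma>)" and q: "q \<in> Hom D (One D) (ctx_sem D d \<Gamma>)"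
    using pq by (auto simp: ctx_rel_def)
  have x: "x \<in> cpts A" and y: "y \<in> dpts A" using lrel_pts[OF xy] by auto
  have "lrel ((A # \<Gamma>) ! i)
      (Comp C (One C) (ctx_sem C c (A # \<Gamma>)) (ty_sem C c ((A # \<Gamma>) ! i)) (var_sem C c (A # \<Gamma>) i)
        (Pairing C (One C) (ctx_sem C c \<Gamma>) (ty_sem C c A) p x))
      (Comp D (One D) (ctx_sem D d (A # \<Gamma>)) (ty_sem D d ((A # \<Gamma>) ! i)) (var_sem D d (A # \<Gamma>) i)
        (Pairing D (One D) (ctx_sem D d \<Gamma>) (ty_sem D d A) q y))" if i: "i < length (A # \<Gamma>)" for i
  proof (cases i)
    case 0
    then show ?thesis using p q x y xy by (simp add: C.Snd_Pairing D.Snd_Pairing objs)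
  next
    case (Suc j)
    then have j: "j < length \<Gamma>" using i by simp
    show ?thesis
      using Suc pq j p q x y C.var_sem_in[OF c j] D.var_sem_in[OF d j]
      by (simp add: ctx_rel_def C.Comp_assoc D.Comp_assoc C.Fst_Pairing D.Fst_Pairing
          C.cat_in D.cat_in objs)
  qed
  then show ?thesis
    using p q x y by (simp add: ctx_rel_def C.cat_in D.cat_in objs)
qed

text \<open>The fundamental lemma of logical relations, by induction on typing. Under an abstraction
  the environments are extended by related arguments.\<close>

lemma lrel_sem:
  "typing \<Gamma> t A \<Longrightarrow> ctx_rel \<Gamma> p q \<Longrightarrow>
    lrel A (Comp C (One C) (ctx_sem C c \<Gamma>) (ty_sem C c A) (sem C c \<Gamma> t) p)
      (Comp D (One D) (ctx_sem D d \<Gamma>) (ty_sem D d A) (sem D d \<Gamma> t) q)"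
proof (induction arbitrary: p q rule: typing.induct)
  case (typing_Var i \<Gamma>)
  then show ?case by (simp add: ctx_rel_def)
next
  case (typing_Lam A \<Gamma> t B)
  have p: "p \<in> Hom C (One C) (ctx_sem C c \<Gamma>)" and q: "q \<in> Hom D (One D) (ctx_sem D d \<Gamma>)"
    using typing_Lam.prems by (auto simp: ctx_rel_def)
  note s = C.sem_in[OF typing_Lam.hyps c] D.sem_in[OF typing_Lam.hyps d]
  have "lrel B
      (capp A B (Comp C (One C) (ctx_sem C c \<Gamma>) (ty_sem C c (TFun A B)) (sem C c \<Gamma> (Lam A t)) p) x)
      (dapp A B (Comp D (One D) (ctx_sem D d \<Gamma>) (ty_sem D d (TFun A B)) (sem D d \<Gamma> (Lam A t)) q) y)"
    if xy: "lrel A x y" for x y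
    using typing_Lam.IH[OF ctx_rel_Cons[OF typing_Lam.prems xy]] lrel_pts[OF xy] s p q
    by (simp add: C.sem_Lam[OF typing_Lam.hyps] D.sem_Lam[OF typing_Lam.hyps]
        C.app_pt_Curry D.app_pt_Curry objs)
  then show ?case
    using s p q
    by (simp add: C.sem_Lam[OF typing_Lam.hyps] D.sem_Lam[OF typing_Lam.hyps]
        C.cat_in D.cat_in objs)
next
  case (typing_App \<Gamma> t A B u)
  have p: "p \<in> Hom C (One C) (ctx_sem C c \<Gamma>)" and q: "q \<in> Hom D (One D) (ctx_sem D d \<Gamma>)"
    using typing_App.prems by (auto simp: ctx_rel_def)
  show ?case
    using typing_App.IH(1)[OF typing_App.prems] typing_App.IH(2)[OF typing_App.prems] p q
      C.sem_in[OF typing_App.hyps(1) c] D.sem_in[OF typing_App.hyps(1) d]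
      C.sem_in[OF typing_App.hyps(2) c] D.sem_in[OF typing_App.hyps(2) d]
    by (simp add: C.sem_App[OF typing_App.hyps] D.sem_App[OF typing_App.hyps]
        C.Comp_Eval_Pairing_pt D.Comp_Eval_Pairing_pt objs)
next
  case (typing_Tup \<Gamma> t A u B)
  have p: "p \<in> Hom C (One C) (ctx_sem C c \<Gamma>)" and q: "q \<in> Hom D (One D) (ctx_sem D d \<Gamma>)"
    using typing_Tup.prems by (auto simp: ctx_rel_def)
  show ?case
    using typing_Tup.IH(1)[OF typing_Tup.prems] typing_Tup.IH(2)[OF typing_Tup.prems] p q
      C.sem_in[OF typing_Tup.hyps(1) c] D.sem_in[OF typing_Tup.hyps(1) d]
      C.sem_in[OF typing_Tup.hyps(2) c] D.sem_in[OF typing_Tup.hyps(2) d]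
    by (simp add: C.sem_Tup[OF typing_Tup.hyps] D.sem_Tup[OF typing_Tup.hyps]
        C.Pairing_Comp D.Pairing_Comp C.Fst_Pairing D.Fst_Pairing C.Snd_Pairing D.Snd_Pairing
        C.cat_in D.cat_in objs)
next
  case (typing_Pr1 \<Gamma> t A B)
  have p: "p \<in> Hom C (One C) (ctx_sem C c \<Gamma>)" and q: "q \<in> Hom D (One D) (ctx_sem D d \<Gamma>)"
    using typing_Pr1.prems by (auto simp: ctx_rel_def)
  show ?case
    using typing_Pr1.IH[OF typing_Pr1.prems] p q
      C.sem_in[OF typing_Pr1.hyps c] D.sem_in[OF typing_Pr1.hyps d]
    by (simp add: C.sem_Pr1[OF typing_Pr1.hyps] D.sem_Pr1[OF typing_Pr1.hyps]
        C.Comp_assoc D.Comp_assoc C.cat_in D.cat_in objs)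
next
  case (typing_Pr2 \<Gamma> t A B)
  have p: "p \<in> Hom C (One C) (ctx_sem C c \<Gamma>)" and q: "q \<in> Hom D (One D) (ctx_sem D d \<Gamma>)"
    using typing_Pr2.prems by (auto simp: ctx_rel_def)
  show ?case
    using typing_Pr2.IH[OF typing_Pr2.prems] p q
      C.sem_in[OF typing_Pr2.hyps c] D.sem_in[OF typing_Pr2.hyps d]
    by (simp add: C.sem_Pr2[OF typing_Pr2.hyps] D.sem_Pr2[OF typing_Pr2.hyps]
        C.Comp_assoc D.Comp_assoc C.cat_in D.cat_in objs)
next
  case (typing_Triv \<Gamma>)
  then show ?case by (simp add: ctx_rel_def C.cat_in D.cat_in objs)
qed

lemma lrel_interp:
  assumes "T \<in> Tm A"
  shows "lrel A (interp C c T) (interp D d T)"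
proof -
  obtain t where t: "typing [] t A" "T = {(t, u). beta_eta [] t u A} `` {t}"
    using assms unfolding Tm_def by (auto elim!: quotientE)
  then have "t \<in> T" by (auto intro: be_refl)
  \<comment> \<open>The identities are the environments for the empty context.\<close>
  moreover have "ctx_rel [] (Id C (One C)) (Id D (One D))"
    by (simp add: ctx_rel_def C.cat_in D.cat_in)
  ultimately show ?thesis
    using lrel_sem[OF t(1), of "Id C (One C)" "Id D (One D)"] C.sem_in[OF t(1) c] D.sem_in[OF t(1) d]
    by (simp add: C.interp_eq[OF assms _ c] D.interp_eq[OF assms _ d] C.Id_right D.Id_right objs)
qed

text \<open>Both halves go through one induction: at \<open>TFun A B\<close> functionality uses
  surjectivity at \<open>A\<close>, and surjectivity uses functionality at \<open>A\<close>. The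
  assumption \<open>full\<close> says that every function on points is represented in
  \<open>C\<close>.\<close>

lemma lrel_partial_surjection:
  assumes wp: "well_pointed D"
    and base_fun: "\<And>x y y'. R x y \<Longrightarrow> R x y' \<Longrightarrow> y \<in> dpts TBase \<Longrightarrow> y' \<in> dpts TBase \<Longrightarrow> y = y'"
    and base_surj: "\<And>y. y \<in> dpts TBase \<Longrightarrow> \<exists>x \<in> cpts TBase. R x y"
    and full: "\<And>a b \<phi>. a \<in> Obj C \<Longrightarrow> b \<in> Obj C \<Longrightarrow>
      \<phi> \<in> Hom C (One C) a \<rightarrow> Hom C (One C) b \<Longrightarrow>
      \<exists>g \<in> Hom C (One C) (Exp C a b). \<forall>x \<in> Hom C (One C) a. C.app_pt a b g x = \<phi> x"
  shows "(\<forall>x y y'. lrel A x y \<longrightarrow> lrel A x y' \<longrightarrow> y = y') \<and> (\<forall>y \<in> dpts A. \<exists>x. lrel A x y)"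
proof (induction A)
  case TBase
  then show ?case using base_fun base_surj by fastforce
next
  case (TFun A B)
  show ?case
  proof (intro conjI allI impI ballI)
    fix x y y' assume xy: "lrel (TFun A B) x y" and xy': "lrel (TFun A B) x y'"
    show "y = y'"
    proof (rule D.app_pt_ext[OF wp])
      fix v assume "v \<in> Hom D (One D) (ty_sem D d A)"
      then obtain u where "lrel A u v" using TFun.IH(1) by blast
      then have "lrel B (capp A B x u) (dapp A B y v)" "lrel B (capp A B x u) (dapp A B y' v)"
        using xy xy' by auto
      then show "dapp A B y v = dapp A B y' v" using TFun.IH(2) by blast
    qed (use xy xy' in \<open>simp_all add: objs\<close>)
  next
    fix h assume h: "h \<in> dpts (TFun A B)"
    \<comment> \<open>\<open>rel x z\<close> says that \<open>z\<close> is an admissible value at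
      \<open>x\<close> for a function related to \<open>h\<close>. If \<open>x\<close> is related to
      nothing, every point of \<open>B\<close> is admissible.\<close>
    define rel where
      "rel x z \<longleftrightarrow> z \<in> cpts B \<and> (\<forall>y. lrel A x y \<longrightarrow> lrel B z (dapp A B h y))" for x z
    have ex: "\<exists>z. rel x z" if x: "x \<in> cpts A" for x
    proof (cases "\<exists>y. lrel A x y")
      case True
      then obtain y where y: "lrel A x y" by blast
      then have "dapp A B h y \<in> dpts B" using h lrel_pts by (simp add: D.app_pt_in objs)
      then obtain z where z: "lrel B z (dapp A B h y)" using TFun.IH(2) by blast
      \<comment> \<open>Functionality at \<open>A\<close> leaves a single constraint on
        \<open>z\<close>.\<close>
      moreover have "y' = y" if "lrel A x y'" for y' using TFun.IH(1) y that by blast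
      ultimately show ?thesis unfolding rel_def using lrel_pts by blast
    next
      case False
      have "cpts B \<noteq> {}"
      proof (cases "inhabited B \<or> cpts TBase \<noteq> {}")
        case True
        then show ?thesis using C.ty_pt_nonempty_iff[OF c, of B] by simp
      next
        case B: False
        \<comment> \<open>The base type has no points in \<open>C\<close>, so the point
          \<open>x\<close> forces \<open>A\<close> to be true and hence to have a point in
          \<open>D\<close>. Applying \<open>h\<close> to it and lifting along surjectivity at
          \<open>B\<close> produces a point of \<open>B\<close> in \<open>C\<close>.\<close>
        then have "inhabited A" using x C.ty_pt_nonempty_iff[OF c, of A] by auto
        then obtain y where "y \<in> dpts A" using D.ty_pt_nonempty_iff[OF d, of A] by auto
        then have "dapp A B h y \<in> dpts B" using h by (simp add: D.app_pt_in objs)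
        then obtain z where "lrel B z (dapp A B h y)" using TFun.IH(2) by blast
        then show ?thesis using lrel_pts by blast
      qed
      then show ?thesis using False unfolding rel_def by blast
    qed
    define \<phi> where "\<phi> x = (SOME z. rel x z)" for x
    have \<phi>: "rel x (\<phi> x)" if "x \<in> cpts A" for x
      unfolding \<phi>_def using ex[OF that] by (rule someI_ex)
    then have "\<phi> \<in> cpts A \<rightarrow> cpts B" by (auto simp: rel_def)
    then obtain g where g: "g \<in> cpts (TFun A B)" "\<And>x. x \<in> cpts A \<Longrightarrow> capp A B g x = \<phi> x"
      using full[OF objs(1) objs(1), of \<phi> A B] by auto
    have "lrel B (capp A B g x) (dapp A B h y)" if "lrel A x y" for x y
      using that lrel_pts[OF that] g(2) \<phi> by (auto simp: rel_def)
    then have "lrel (TFun A B) g h" using g(1) h by simp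
    then show "\<exists>x. lrel (TFun A B) x h" ..
  qed
next
  case (TProd A B)
  let ?a = "ty_sem D d A" and ?b = "ty_sem D d B"
  show ?case
  proof (intro conjI allI impI ballI)
    fix x y y' assume "lrel (TProd A B) x y" "lrel (TProd A B) x y'"
    moreover from this have "Comp D (One D) (Prd D ?a ?b) ?a (Fst D ?a ?b) y =
        Comp D (One D) (Prd D ?a ?b) ?a (Fst D ?a ?b) y'"
      "Comp D (One D) (Prd D ?a ?b) ?b (Snd D ?a ?b) y =
        Comp D (One D) (Prd D ?a ?b) ?b (Snd D ?a ?b) y'"
      using TProd.IH by auto
    ultimately show "y = y'"
      using D.Pairing_unique[of "One D" ?a ?b y] D.Pairing_unique[of "One D" ?a ?b y']
      by (simp add: objs)
  next
    fix y assume y: "y \<in> dpts (TProd A B)"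
    then have "Comp D (One D) (Prd D ?a ?b) ?a (Fst D ?a ?b) y \<in> dpts A"
      "Comp D (One D) (Prd D ?a ?b) ?b (Snd D ?a ?b) y \<in> dpts B"
      by (simp_all add: D.cat_in objs)
    then obtain u v where
      "lrel A u (Comp D (One D) (Prd D ?a ?b) ?a (Fst D ?a ?b) y)"
      "lrel B v (Comp D (One D) (Prd D ?a ?b) ?b (Snd D ?a ?b) y)"
      using TProd.IH by blast
    moreover from this have "u \<in> cpts A" "v \<in> cpts B" using lrel_pts by auto
    ultimately have "lrel (TProd A B)
        (Pairing C (One C) (ty_sem C c A) (ty_sem C c B) u v) y"
      using y by (simp add: C.Fst_Pairing C.Snd_Pairing C.cat_in objs)
    then show "\<exists>x. lrel (TProd A B) x y" ..
  qed
next
  case TUnit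
  have "y = y'" if "y \<in> dpts TUnit" "y' \<in> dpts TUnit" for y y'
    using that D.Bang_unique[OF D.One_in] by (metis ty_sem.simps(4))
  moreover have "Id C (One C) \<in> cpts TUnit" by (simp add: C.cat_in)
  ultimately show ?case by auto
qed

end

section \<open>Finite sets\<close>

interpretation FinSet: cartesian_closed FinSet
  by (rule cartesian_closed_FinSet)

text \<open>Points are elements, and the exponential consists of the graphs of all
  functions.\<close>

lemma FinSet_full_on_points:
  assumes "X \<in> Obj FinSet" "Y \<in> Obj FinSet"
    and \<phi>: "\<phi> \<in> Hom FinSet (One FinSet) X \<rightarrow> Hom FinSet (One FinSet) Y"
  shows "\<exists>g \<in> Hom FinSet (One FinSet) (Exp FinSet X Y).
    \<forall>x \<in> Hom FinSet (One FinSet) X. FinSet.app_pt X Y g x = \<phi> x"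
proof -
  have X: "finite X" using assms(1) by (simp add: FinSet_def)
  have \<phi>': "\<phi> x \<in> {Star} \<rightarrow>\<^sub>E Y" if "x \<in> {Star} \<rightarrow>\<^sub>E X" for x
    using \<phi> that by (auto simp: FinSet_def)
  \<comment> \<open>\<open>\<phi>\<close> carried over from points to elements: \<open>x\<close>
    becomes the constant map at \<open>x\<close>, and the value is read off at
    \<open>Star\<close>.\<close>
  define f where "f = (\<lambda>x\<in>X. \<phi> (\<lambda>_\<in>{Star}. x) Star)"
  have f: "f \<in> X \<rightarrow>\<^sub>E Y"
    unfolding f_def using \<phi>' by (fastforce simp: PiE_iff)
  define g where "g = (\<lambda>_\<in>{Star}. graph X f)"
  have g: "g \<in> Hom FinSet (One FinSet) (Exp FinSet X Y)"
    using f by (auto simp: FinSet_def g_def)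
  have "FinSet.app_pt X Y g x = \<phi> x" if "x \<in> Hom FinSet (One FinSet) X" for x
  proof -
    have x: "x \<in> {Star} \<rightarrow>\<^sub>E X" using that by (simp add: FinSet_def)
    then have xS: "x Star \<in> X" and x_eq: "(\<lambda>_\<in>{Star}. x Star) = x"
      by (auto simp: fun_eq_iff PiE_iff extensional_def)
    \<comment> \<open>\<open>Eval\<close> is a restricted function, so the pair must be shown to lie
      in its domain.\<close>
    have "EPair (graph X f) (x Star) \<in> {EPair (graph X f) x | f x. f \<in> X \<rightarrow>\<^sub>E Y \<and> x \<in> X}"
      using f xS by blast
    then have "FinSet.app_pt X Y g x = (\<lambda>_\<in>{Star}. f (x Star))"
      unfolding FinSet.app_pt_def
      using X xS by (simp add: FinSet_def compose_def g_def eapp_graph fun_eq_iff)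
    also have "f (x Star) = \<phi> x Star"
      using xS by (simp add: f_def x_eq)
    also have "(\<lambda>_\<in>{Star}. \<phi> x Star) = \<phi> x"
      using \<phi>'[OF x] by (auto simp: fun_eq_iff PiE_iff extensional_def)
    finally show ?thesis .
  qed
  then show ?thesis using g by blast
qed

theorem theorem5p9:
  fixes E :: "('o, 'm) cat" and A :: ty and e :: 'o and F :: "'m set"
  assumes "cartesian_closed E" and "well_pointed E" and "locally_finite E"
    and "e \<in> Obj E" and "F \<subseteq> Hom E (One E) (ty_sem E e A)"
  shows "\<exists>Q F'. Q \<in> Obj FinSet \<and> F' \<subseteq> ty_sem FinSet Q A \<and>
    {t \<in> Tm A. interp E e t \<in> F} = {t \<in> Tm A. point_elt (interp FinSet Q t) \<in> F'}"
proof -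
  interpret E: cartesian_closed E by fact
  let ?P = "Hom E (One E) e"
  have "finite ?P"
    using assms(3,4) E.One_in by (simp add: locally_finite_def)
  then obtain k :: "'m \<Rightarrow> nat" where k: "inj_on k ?P"
    using finite_imp_inj_to_nat_seg by blast
  \<comment> \<open>The points of \<open>e\<close> live in an arbitrary type; local finiteness lets
    \<open>k\<close> code them injectively as atoms.\<close>
  define Q where "Q = (Atom \<circ> k) ` ?P"
  have Q: "Q \<in> Obj FinSet" using \<open>finite ?P\<close> by (simp add: Q_def FinSet_def)
  interpret base_relation FinSet E Q e "\<lambda>x y. point_elt x = Atom (k y)"
    by unfold_locales (use Q assms(4) in auto)
  have pt: "bij_betw point_elt (Hom FinSet (One FinSet) X) X" for X
    by (rule bij_betw_point_elt)
  have base_surj: "\<exists>x \<in> cpts TBase. point_elt x = Atom (k y)" if "y \<in> dpts TBase" for y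
  proof -
    have "Atom (k y) \<in> point_elt ` cpts TBase"
      using that bij_betw_imp_surj_on[OF pt, of Q] by (simp add: Q_def)
    then show ?thesis by (metis imageE)
  qed
  have surj: "(\<forall>x y y'. lrel A x y \<longrightarrow> lrel A x y' \<longrightarrow> y = y') \<and> (\<forall>y \<in> dpts A. \<exists>x. lrel A x y)"
    by (rule lrel_partial_surjection[OF assms(2) _ base_surj FinSet_full_on_points])
      (use k in \<open>auto dest: inj_onD\<close>)
  \<comment> \<open>The preimage of \<open>F\<close> under the relation. By functionality an element
    of \<open>F'\<close> is related to nothing outside \<open>F\<close>.\<close>
  define F' where "F' = {point_elt x | x y. lrel A x y \<and> y \<in> F}"
  have "F' \<subseteq> ty_sem FinSet Q A"
    using lrel_pts bij_betw_imp_surj_on[OF pt, of "ty_sem FinSet Q A"] by (auto simp: F'_def)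
  moreover have "interp E e t \<in> F \<longleftrightarrow> point_elt (interp FinSet Q t) \<in> F'" if t: "t \<in> Tm A" for t
  proof
    show "point_elt (interp FinSet Q t) \<in> F'" if "interp E e t \<in> F"
      using that lrel_interp[OF t] by (auto simp: F'_def)
  next
    assume "point_elt (interp FinSet Q t) \<in> F'"
    then obtain x y where xy: "point_elt (interp FinSet Q t) = point_elt x" "lrel A x y" "y \<in> F"
      by (auto simp: F'_def)
    then have "interp FinSet Q t = x"
      using bij_betw_imp_inj_on[OF pt, of "ty_sem FinSet Q A"] lrel_pts[OF xy(2)]
        lrel_pts[OF lrel_interp[OF t]] by (simp add: inj_on_eq_iff)
    then have "interp E e t = y" using surj lrel_interp[OF t] xy(2) by blast
    then show "interp E e t \<in> F" using xy(3) by simp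
  qed
  ultimately show ?thesis using Q by blast
qed

end
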